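(* Under the standing setting: (a) If $f_0=0$ and $f_\infty\in(0,\infty)$, then there exist $\lambda_*\in(0,\infty)$ and $m_*\in(0,\infty]$ such that for every $\lambda\in(\lambda_*,\infty)$ problem (P$_\lambda$) has a positive solution $u(\lambda)$ with $\|u(\lambda)\|_\infty\in(0,m_* )$, these solutions can be chosen so that $\lim_{\lambda\to\infty}\|u(\lambda)\|_\infty=0$, and, if $m_*\in(0,\infty)$, problem (P$_{\lambda_*}$) has a positive solution. (b) If $f_0\in(0,\infty)$ and $f_\infty=0$, then there exist $\lambda_*\in(0,\infty)$ and $m_*\in[0,\infty)$ such that for every $\lambda\in(\lambda_*,\infty)$ problem (P$_\lambda$) has a positive solution $u(\lambda)$ with $\|u(\lambda)\|_\infty\in(m_*,\infty)$, these solutions can be chosen so that $\lim_{\lambda\to\infty}\|u(\lambda)\|_\infty=\infty$, and, if $m_*\in(0,\infty)$, problem (P$_{\lambda_*}$) has a positive solution.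
   Context: Standing setting. $\varphi:\mathbb{R}\to\mathbb{R}$ is an odd, increasing homeomorphism satisfying condition (A): there exist increasing homeomorphisms $\psi_1,\psi_2:[0,\infty)\to[0,\infty)$ such that $\varphi(x)\psi_1(y)\le \varphi(xy)\le \varphi(x)\psi_2(y)$ for all $x,y\ge 0$. Let $c,d\in C([0,1],(0,\infty))$, and $\|\cdot\|_\infty$ the maximum norm on $C[0,1]$. Let $f\in C([0,\infty),[0,\infty))$ with $f(s)>0$ for $s>0$, and write $f_0=\lim_{s\to0^+}f(s)/\varphi(s)$, $f_\infty=\lim_{s\to\infty}f(s)/\varphi(s)$ (assumed to exist in $[0,\infty]$ whenever referred to). Let $h\in C((0,1),[0,\infty))$, $h\not\equiv 0$, with $\int_0^{1/2}\psi_1^{-1}\big(\int_s^{1/2}h(\tau)d\tau\big)ds+\int_{1/2}^1\psi_1^{-1}\big(\int_{1/2}^s h(\tau)d\tau\big)ds<\infty$. Notation attached to $h$: $\alpha_h=\sup\{x\in(0,1): h=0 \text{ on }(0,x)\}$ ($0$ if empty); $\beta_h=\inf\{x\in(0,1): h=0\text{ on }(x,1)\}$ ($1$ if empty); $\bar\alpha_h=\sup\{x\in(\alpha_h,1]: h>0 \text{ on }(\alpha_h,x)\}$; $\bar\beta_h=\inf\{x\in[0,\beta_h): h>0\text{ on }(x,\beta_h)\}$; $\gamma_h^1=(3\alpha_h+\bar\alpha_h)/4$, $\gamma_h^2=(\bar\beta_h+3\beta_h)/4$. It is assumed that $0\le\alpha_h<\gamma_h^1<\gamma_h^2<\beta_h\le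 1$. For $\lambda\ge0$, problem (P$_\lambda$) is: $(d(t)\varphi(c(t)u'(t)))'+\lambda h(t)f(u(t))=0$ for $t\in(0,1)$, $u(0)=u(1)=0$. A solution is $u\in C[0,1]\cap C^1(0,1)$ such that $t\mapsto d(t)\varphi(c(t)u'(t))$ is continuously differentiable on $(0,1)$ and the equation and boundary conditions hold; it is positive if $u(t)>0$ for all $t\in(0,1)$. *)

theory Defs
  imports "HOL-Analysis.Analysis"
begin

definition odd_incr_homeo :: "(real \<Rightarrow> real) \<Rightarrow> bool" where
  "odd_incr_homeo \<phi> \<longleftrightarrow> (\<forall>x. \<phi> (-x) = - \<phi> x) \<and> strict_mono \<phi> \<and>
     (\<exists>g. homeomorphism UNIV UNIV \<phi> g)"

definition incr_homeo_nonneg :: "(real \<Rightarrow> real) \<Rightarrow> bool" where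
  "incr_homeo_nonneg \<psi> \<longleftrightarrow> strict_mono_on {0..} \<psi> \<and>
     (\<exists>g. homeomorphism {0..} {0..} \<psi> g)"

definition condA :: "(real \<Rightarrow> real) \<Rightarrow> (real \<Rightarrow> real) \<Rightarrow> (real \<Rightarrow> real) \<Rightarrow> bool" where
  "condA \<phi> \<psi>1 \<psi>2 \<longleftrightarrow> incr_homeo_nonneg \<psi>1 \<and> incr_homeo_nonneg \<psi>2 \<and>
     (\<forall>x\<ge>0. \<forall>y\<ge>0. \<phi> x * \<psi>1 y \<le> \<phi> (x * y) \<and> \<phi> (x * y) \<le> \<phi> x * \<psi>2 y)"

definition sup_norm01 :: "(real \<Rightarrow> real) \<Rightarrow> real" where
  "sup_norm01 u = Sup ((\<lambda>t. \<bar>u t\<bar>) ` {0..1})"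

definition is_solution ::
  "(real \<Rightarrow> real) \<Rightarrow> (real \<Rightarrow> real) \<Rightarrow> (real \<Rightarrow> real) \<Rightarrow> (real \<Rightarrow> real) \<Rightarrow>
   (real \<Rightarrow> real) \<Rightarrow> real \<Rightarrow> (real \<Rightarrow> real) \<Rightarrow> bool" where
  "is_solution \<phi> c d h f lam u \<longleftrightarrow>
     continuous_on {0..1} u \<and>
     (\<exists>u'. (\<forall>t\<in>{0<..<1}. (u has_real_derivative u' t) (at t)) \<and>
           continuous_on {0<..<1} u' \<and>
           (\<exists>w'. (\<forall>t\<in>{0<..<1}. ((\<lambda>s. d s * \<phi> (c s * u' s)) has_real_derivative w' t) (at t)) \<and>
                 continuous_on {0<..<1} w' \<and>
                 (\<forall>t\<in>{0<..<1}. w' t + lam * h t * f (u t) = 0))) \<and>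
     u 0 = 0 \<and> u 1 = 0"

definition is_pos_solution ::
  "(real \<Rightarrow> real) \<Rightarrow> (real \<Rightarrow> real) \<Rightarrow> (real \<Rightarrow> real) \<Rightarrow> (real \<Rightarrow> real) \<Rightarrow>
   (real \<Rightarrow> real) \<Rightarrow> real \<Rightarrow> (real \<Rightarrow> real) \<Rightarrow> bool" where
  "is_pos_solution \<phi> c d h f lam u \<longleftrightarrow>
     is_solution \<phi> c d h f lam u \<and> (\<forall>t\<in>{0<..<1}. u t > 0)"

text \<open>The numbers attached to h.  Defaults for empty sets: alpha_h = 0, beta_h = 1 (as in the
  paper); alphabar_h = alpha_h and betabar_h = beta_h (then the standing ordering assumption fails).\<close>
definition alpha_h :: "(real \<Rightarrow> real) \<Rightarrow> real" where
  "alpha_h h = (let S = {x\<in>{0<..<1}. \<forall>t\<in>{0<..<x}. h t = 0} in if S = {} then 0 else Sup S)"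

definition beta_h :: "(real \<Rightarrow> real) \<Rightarrow> real" where
  "beta_h h = (let S = {x\<in>{0<..<1}. \<forall>t\<in>{x<..<1}. h t = 0} in if S = {} then 1 else Inf S)"

definition alphabar_h :: "(real \<Rightarrow> real) \<Rightarrow> real" where
  "alphabar_h h = (let a = alpha_h h; S = {x\<in>{a<..1}. \<forall>t\<in>{a<..<x}. h t > 0}
                   in if S = {} then a else Sup S)"

definition betabar_h :: "(real \<Rightarrow> real) \<Rightarrow> real" where
  "betabar_h h = (let b = beta_h h; S = {x\<in>{0..<b}. \<forall>t\<in>{x<..<b}. h t > 0}
                  in if S = {} then b else Inf S)"

definition gamma1_h :: "(real \<Rightarrow> real) \<Rightarrow> real" where
  "gamma1_h h = (3 * alpha_h h + alphabar_h h) / 4"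

definition gamma2_h :: "(real \<Rightarrow> real) \<Rightarrow> real" where
  "gamma2_h h = (betabar_h h + 3 * beta_h h) / 4"

definition h_condition :: "(real \<Rightarrow> real) \<Rightarrow> (real \<Rightarrow> real) \<Rightarrow> bool" where
  "h_condition \<psi>1 h \<longleftrightarrow>
     (\<integral>\<^sup>+ s. ennreal (inv_into {0..} \<psi>1 (integral {s..1/2} h)) * indicator {0<..1/2} s \<partial>lborel)
   + (\<integral>\<^sup>+ s. ennreal (inv_into {0..} \<psi>1 (integral {1/2..s} h)) * indicator {1/2..<1} s \<partial>lborel)
     < \<infinity>"

end

theory Submission
  imports Defs "HOL-Complex_Analysis.Great_Picard"
begin

text \<open>
  Choosing \<open>m\<^sub>* = \<infinity>\<close> in (a) and \<open>m\<^sub>* = 0\<close> in (b), it suffices to find, for all large \<open>lam\<close>,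
  positive solutions whose norms tend to \<open>0\<close>, respectively to infinity.  Fix two levels p and q.  If f
  is at most a small (depending on \<open>lam\<close>) multiple of \<open>\<phi> p\<close> on \<open>[0, p]\<close>, which holds for small p when
  \<open>f\<^sub>0 = 0\<close> and for large p when \<open>f\<^sub>\<infinity> = 0\<close>, a trajectory starting at \<open>u(0) = 0\<close> with maximum p is still
  positive at the right end; if \<open>lam\<close> is large depending on q, a trajectory with maximum q has become
  negative there.  So shooting from the left end finds a solution whose norm lies between p and q.

  Since f and the inverse of \<open>\<phi>\<close> are merely continuous and h may be non-integrable at the ends of the
  interval, shooting is carried out on \<open>[a, 1 - a]\<close> with the delayed argument \<open>u(t - a)\<close> inside f.  The
  delayed problem is solved by finitely many explicit integrations, hence depends continuously on the
  initial flux.  The integrability condition on h dominates the slopes of these approximations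
  uniformly, and Arzela--Ascoli gives a solution as a tends to 0.
\<close>

subsection \<open>Differential inequalities for delayed solutions\<close>

text \<open>The sign of u at the right end is decided by the norm of the trajectory, not by its
  initial flux, so the two levels may come in either order. The lower bound on \<open>lam\<close>
  depends on q alone, while p is chosen once \<open>lam\<close> is known; hence one two-level
  statement yields norms at most q when f is small relative to \<phi> near 0, and norms at least q
  when it is small near infinity.

  Two obstacles shape the estimates. With variable c and d a solution need not be concave, so the
  usual lower bound by the distance to the boundary is replaced by one carrying a constant
  \<open>\<kappa>\<close>. And the flux may be unbounded near 0 and 1, so it is never measured from
  there: H is normalised at 1/2, the constant of integration of the flux is fixed at the peak, where
  the flux vanishes, and the peaks are shown to stay in a fixed compact subinterval of the open
  interval.

  Each q has its own threshold for \<open>lam\<close>, so a family with the required limit is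
  obtained by a nearly optimal choice at every \<open>lam\<close>.\<close>

lemma open_interval_antiderivative:
  fixes g :: "real \<Rightarrow> real"
  assumes "continuous_on {0<..<1} g"
  obtains G where "G x0 = 0" "\<And>t. t \<in> {0<..<1} \<Longrightarrow> (G has_real_derivative g t) (at t)"
proof -
  have "\<And>x::real. ereal 0 < ereal x \<Longrightarrow> ereal x < ereal 1 \<Longrightarrow> isCont g x"
    using assms by (auto simp: continuous_on_eq_continuous_at)
  from einterval_antiderivative[of "ereal 0" "ereal 1", OF _ this] obtain K where
    K: "\<And>x. 0 < x \<Longrightarrow> x < 1 \<Longrightarrow> (K has_vector_derivative g x) (at x)"
    by force
  show thesis
  proof (rule that[of "\<lambda>t. K t - K x0"])
    fix t :: real assume "t \<in> {0<..<1}"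
    then have "(K has_real_derivative g t) (at t)"
      using K by (simp add: has_real_derivative_iff_has_vector_derivative)
    then show "((\<lambda>t. K t - K x0) has_real_derivative g t) (at t)"
      by (auto intro!: derivative_eq_intros)
  qed simp
qed

lemma diff_le_diff_of_deriv_le:
  fixes u v u' v' :: "real \<Rightarrow> real"
  assumes "x \<le> y" "continuous_on {x..y} u" "continuous_on {x..y} v"
    and "\<And>t. x < t \<Longrightarrow> t < y \<Longrightarrow> (u has_real_derivative u' t) (at t)"
    and "\<And>t. x < t \<Longrightarrow> t < y \<Longrightarrow> (v has_real_derivative v' t) (at t)"
    and "\<And>t. x < t \<Longrightarrow> t < y \<Longrightarrow> u' t \<le> v' t"
  shows "u y - u x \<le> v y - v x"
proof -
  have "(\<lambda>t. v t - u t) x \<le> (\<lambda>t. v t - u t) y"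
  proof (rule DERIV_nonneg_imp_increasing_open[OF assms(1)])
    fix t assume t: "x < t" "t < y"
    have "((\<lambda>t. v t - u t) has_real_derivative v' t - u' t) (at t)"
      by (intro DERIV_diff assms t)
    then show "\<exists>z. ((\<lambda>t. v t - u t) has_real_derivative z) (at t) \<and> 0 \<le> z"
      using assms(6)[OF t] by fastforce
  qed (intro continuous_intros assms)
  then show ?thesis by simp
qed

lemma diff_le_of_deriv_le:
  fixes u u' :: "real \<Rightarrow> real"
  assumes "x \<le> y" "continuous_on {x..y} u"
    and "\<And>t. x < t \<Longrightarrow> t < y \<Longrightarrow> (u has_real_derivative u' t) (at t)"
    and "\<And>t. x < t \<Longrightarrow> t < y \<Longrightarrow> u' t \<le> C"
  shows "u y - u x \<le> C * (y - x)"
proof -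
  have "u y - u x \<le> C * y - C * x"
    by (rule diff_le_diff_of_deriv_le[where v'="\<lambda>_. C"])
       (auto intro!: assms continuous_intros derivative_eq_intros)
  then show ?thesis by (simp add: algebra_simps)
qed

lemma diff_ge_of_deriv_ge:
  fixes u u' :: "real \<Rightarrow> real"
  assumes "x \<le> y" "continuous_on {x..y} u"
    and "\<And>t. x < t \<Longrightarrow> t < y \<Longrightarrow> (u has_real_derivative u' t) (at t)"
    and "\<And>t. x < t \<Longrightarrow> t < y \<Longrightarrow> C \<le> u' t"
  shows "C * (y - x) \<le> u y - u x"
proof -
  have "C * y - C * x \<le> u y - u x"
    by (rule diff_le_diff_of_deriv_le[where u'="\<lambda>_. C"])
       (auto intro!: assms continuous_intros derivative_eq_intros)
  then show ?thesis by (simp add: algebra_simps)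
qed

text \<open>
  Here k is the inverse of \<open>\<phi>\<close>, J the inverse of \<open>\<psi>\<^sub>1\<close>, and F the extension of f to the line that is
  constant on the negative axis.  Condition (A) enters only through \<open>k_mult\<close>, and the integrability
  condition on h only through the continuity of P up to the end points.
\<close>

locale phi_bvp =
  fixes k J c d h H P F :: "real \<Rightarrow> real" and c0 c1 d0 d1 :: real
  assumes k_cont: "continuous_on UNIV k" and k_mono: "strict_mono k"
    and k_odd: "\<And>x. k (- x) = - k x"
    and k_unbounded: "\<And>B. \<exists>x\<ge>0. B \<le> k x"
    and J_nonneg: "\<And>y. 0 \<le> y \<Longrightarrow> 0 \<le> J y"
    and k_mult: "\<And>z y. 0 \<le> z \<Longrightarrow> 0 \<le> y \<Longrightarrow> k (z * y) \<le> k z * J y"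
    and c_cont: "continuous_on {0..1} c" and d_cont: "continuous_on {0..1} d"
    and c0: "0 < c0" and d0: "0 < d0"
    and c_bounds: "\<And>t. t \<in> {0..1} \<Longrightarrow> c0 \<le> c t \<and> c t \<le> c1"
    and d_bounds: "\<And>t. t \<in> {0..1} \<Longrightarrow> d0 \<le> d t \<and> d t \<le> d1"
    and h_cont: "continuous_on {0<..<1} h" and h_nonneg: "\<And>t. t \<in> {0<..<1} \<Longrightarrow> 0 \<le> h t"
    and H_half: "H (1/2) = 0"
    and H_deriv: "\<And>t. t \<in> {0<..<1} \<Longrightarrow> (H has_real_derivative h t) (at t)"
    and P_cont: "continuous_on {0..1} P"
    and P_deriv: "\<And>t. t \<in> {0<..<1} \<Longrightarrow> (P has_real_derivative J \<bar>H t\<bar>) (at t)"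
    and F_cont: "continuous_on UNIV F" and F_nonneg: "\<And>x. 0 \<le> F x"
begin

lemma k_zero [simp]: "k 0 = 0"
  using k_odd[of 0] by simp

lemma k_le: "k x \<le> k y \<longleftrightarrow> x \<le> y"
  using k_mono by (rule strict_mono_less_eq)

lemma k_less: "k x < k y \<longleftrightarrow> x < y"
  using k_mono by (rule strict_mono_less)

lemma k_nonneg: "0 \<le> k x \<longleftrightarrow> 0 \<le> x"
  using k_le[of 0 x] by simp

lemma k_nonpos: "k x \<le> 0 \<longleftrightarrow> x \<le> 0"
  using k_le[of x 0] by simp

lemma c1: "0 < c1" and d1: "0 < d1"
  using c_bounds[of 0] d_bounds[of 0] c0 d0 by auto

lemma c_pos: "t \<in> {0..1} \<Longrightarrow> 0 < c t" and d_pos: "t \<in> {0..1} \<Longrightarrow> 0 < d t"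
  using c_bounds[of t] d_bounds[of t] c0 d0 by auto

lemma H_cont: "continuous_on {0<..<1} H"
  by (meson DERIV_isCont H_deriv continuous_at_imp_continuous_on)

lemma H_mono: "0 < x \<Longrightarrow> x \<le> y \<Longrightarrow> y < 1 \<Longrightarrow> H x \<le> H y"
  using diff_ge_of_deriv_ge[of x y H h 0] H_deriv h_nonneg continuous_on_subset[OF H_cont, of "{x..y}"]
  by (fastforce simp: subset_eq)

lemma P_mono: "0 \<le> x \<Longrightarrow> x \<le> y \<Longrightarrow> y \<le> 1 \<Longrightarrow> P x \<le> P y"
  using diff_ge_of_deriv_ge[of x y P "\<lambda>t. J \<bar>H t\<bar>" 0] P_deriv J_nonneg
    continuous_on_subset[OF P_cont, of "{x..y}"]
  by auto

text \<open>This is the derivative u' recovered from the flux w = d \<phi>(c u'). Working with the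
  pair (u, w) turns the equation into a first-order system.\<close>

definition slope :: "real \<Rightarrow> real \<Rightarrow> real" where
  "slope t w = k (w / d t) / c t"

lemma slope_le_pos:
  assumes "t \<in> {0..1}" "w \<le> W" "0 \<le> W"
  shows "slope t w \<le> k (W / d0) / c0"
proof (cases "w \<le> 0")
  case True
  then have "slope t w \<le> 0"
    using c_pos[OF assms(1)] d_pos[OF assms(1)]
    by (simp add: slope_def divide_le_0_iff k_nonpos)
  also have "0 \<le> k (W / d0) / c0"
    using assms c0 d0 by (simp add: k_nonneg)
  finally show ?thesis .
next
  case False
  have "w / d t \<le> W / d0"
    using False assms d_bounds[of t] d0 by (intro frac_le) auto
  then have "k (w / d t) \<le> k (W / d0)" by (simp add: k_le)
  then show ?thesis
    unfolding slope_def using False assms c_bounds[of t] c0 d0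
    by (intro frac_le) (auto simp: k_nonneg)
qed

lemma slope_ge_pos:
  assumes "t \<in> {0..1}" "W \<le> w" "0 \<le> W"
  shows "k (W / d1) / c1 \<le> slope t w"
proof -
  have "W / d1 \<le> w / d t"
    using assms d_bounds[of t] d0 by (intro frac_le) auto
  then have "k (W / d1) \<le> k (w / d t)" by (simp add: k_le)
  then show ?thesis
    unfolding slope_def using assms c_bounds[of t] c_pos[of t] d_pos[of t] c0 d1
    by (intro frac_le) (auto simp: k_nonneg)
qed

lemma slope_minus: "slope t (- w) = - slope t w"
  by (simp add: slope_def k_odd)

text \<open>The price of replacing c and d by their bounds: at equal flux, the largest possible
  slope is at most \<open>\<kappa>\<close> times the smallest possible one. The factor J (d1 / d0)
  comes from \<open>k_mult\<close> applied to W / d0 = (W / d1) * (d1 / d0).\<close>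

definition \<kappa> :: real where "\<kappa> = c1 / c0 * J (d1 / d0)"

lemma \<kappa>_nonneg: "0 \<le> \<kappa>"
  using c0 c1 d0 d1 by (simp add: \<kappa>_def J_nonneg)

lemma slope_ratio:
  assumes "0 \<le> W"
  shows "k (W / d0) / c0 \<le> \<kappa> * (k (W / d1) / c1)"
proof -
  have "k (W / d0) = k ((W / d1) * (d1 / d0))" using d1 by simp
  also have "\<dots> \<le> k (W / d1) * J (d1 / d0)"
    by (rule k_mult) (use assms d0 d1 in auto)
  finally show ?thesis
    unfolding \<kappa>_def using c0 c1 by (simp add: field_simps)
qed

text \<open>Arithmetic core of the substitute for concavity. A is a height reached over a length L
  with slope at least S, and B a further gain over a length M with slope at most T; then B * L is at
  most \<open>\<kappa>\<close> * S * L * M, and S * L is at most A.\<close>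

lemma weighted_concavity:
  assumes "0 \<le> S" "S * L \<le> A" "B \<le> T * M" "T \<le> \<kappa> * S" "0 \<le> L" "0 \<le> M" "L + M \<le> 1"
  shows "(A + B) * L \<le> (1 + \<kappa>) * (A::real)"
proof -
  have SL: "0 \<le> S * L" using assms by simp
  then have A: "0 \<le> A" using assms by linarith
  have "B * L \<le> (\<kappa> * S * M) * L"
    using assms mult_right_mono[of T "\<kappa> * S" M] by (intro mult_right_mono) auto
  also have "\<dots> = \<kappa> * (S * L) * M" by simp
  also have "\<dots> \<le> \<kappa> * (S * L) * 1"
    using assms SL \<kappa>_nonneg by (intro mult_left_mono mult_nonneg_nonneg) auto
  also have "\<dots> \<le> \<kappa> * A" using assms \<kappa>_nonneg by (simp add: mult_left_mono)
  finally have "B * L \<le> \<kappa> * A" .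
  moreover have "A * L \<le> A * 1"
    using assms A by (intro mult_left_mono) auto
  ultimately show ?thesis by (simp add: algebra_simps)
qed

text \<open>The clamp \<open>max a (t - \<delta>)\<close> keeps the delayed argument inside the
  interval; where it acts, it reads the initial value u a = 0.\<close>

definition delayed_sol :: "real \<Rightarrow> real \<Rightarrow> real \<Rightarrow> real \<Rightarrow> (real \<Rightarrow> real) \<Rightarrow> (real \<Rightarrow> real) \<Rightarrow> bool" where
  "delayed_sol lam \<delta> a b u w \<longleftrightarrow> continuous_on {a..b} u \<and> continuous_on {a..b} w \<and> u a = 0 \<and>
     (\<forall>t\<in>{a<..<b}. (u has_real_derivative slope t (w t)) (at t) \<and>
        (w has_real_derivative - (lam * (h t * F (u (max a (t - \<delta>)))))) (at t))"

context
  fixes lam \<delta> a b u w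
  assumes sol: "delayed_sol lam \<delta> a b u w"
    and lam: "0 \<le> lam" and ab: "0 < a" "a < b" "b < 1"
begin

lemma u_cont: "a \<le> x \<Longrightarrow> y \<le> b \<Longrightarrow> continuous_on {x..y} u"
  and w_cont: "a \<le> x \<Longrightarrow> y \<le> b \<Longrightarrow> continuous_on {x..y} w"
  using sol by (auto simp: delayed_sol_def intro: continuous_on_subset)

lemma u_start: "u a = 0"
  using sol by (auto simp: delayed_sol_def)

lemma u_deriv: "a < t \<Longrightarrow> t < b \<Longrightarrow> (u has_real_derivative slope t (w t)) (at t)"
  and w_deriv: "a < t \<Longrightarrow> t < b \<Longrightarrow>
    (w has_real_derivative - (lam * (h t * F (u (max a (t - \<delta>)))))) (at t)"
  using sol by (auto simp: delayed_sol_def)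

lemma w_decr: "a \<le> x \<Longrightarrow> x \<le> y \<Longrightarrow> y \<le> b \<Longrightarrow> w y \<le> w x"
  using diff_le_of_deriv_le[of x y w "\<lambda>t. - (lam * (h t * F (u (max a (t - \<delta>)))))" 0]
    w_cont[of x y] w_deriv lam h_nonneg F_nonneg ab by force

lemma u_gain:
  assumes "a \<le> x" "x \<le> y" "y \<le> b" "W \<le> w y" "0 \<le> W"
  shows "k (W / d1) / c1 * (y - x) \<le> u y - u x"
proof (rule diff_ge_of_deriv_ge)
  fix t assume t: "x < t" "t < y"
  then have "w y \<le> w t" using assms by (intro w_decr) auto
  then show "k (W / d1) / c1 \<le> slope t (w t)"
    using assms t ab by (intro slope_ge_pos) auto
qed (use assms u_cont u_deriv in auto)

lemma u_loss:
  assumes "a \<le> x" "x \<le> y" "y \<le> b" "W \<le> - w x" "0 \<le> W"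
  shows "k (W / d1) / c1 * (y - x) \<le> u x - u y"
proof -
  have "u y - u x \<le> - (k (W / d1) / c1) * (y - x)"
  proof (rule diff_le_of_deriv_le)
    fix t assume t: "x < t" "t < y"
    then have "w t \<le> w x" using assms by (intro w_decr) auto
    then have "k (W / d1) / c1 \<le> slope t (- w t)"
      using assms t ab by (intro slope_ge_pos) auto
    then show "slope t (w t) \<le> - (k (W / d1) / c1)" by (simp add: slope_minus)
  qed (use assms u_cont u_deriv in auto)
  then show ?thesis by simp
qed

lemma u_gain_le:
  assumes "a \<le> x" "x \<le> y" "y \<le> b" "0 \<le> w x"
  shows "u y - u x \<le> k (w x / d0) / c0 * (y - x)"
proof (rule diff_le_of_deriv_le)
  fix t assume t: "x < t" "t < y"
  then have "w t \<le> w x" using assms by (intro w_decr) auto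
  then show "slope t (w t) \<le> k (w x / d0) / c0"
    using assms t ab by (intro slope_le_pos) auto
qed (use assms u_cont u_deriv in auto)

lemma u_loss_le:
  assumes "a \<le> x" "x \<le> y" "y \<le> b" "w y \<le> 0"
  shows "u x - u y \<le> k (- w y / d0) / c0 * (y - x)"
proof -
  have "- (k (- w y / d0) / c0) * (y - x) \<le> u y - u x"
  proof (rule diff_ge_of_deriv_ge)
    fix t assume t: "x < t" "t < y"
    then have "w y \<le> w t" using assms by (intro w_decr) auto
    then have "slope t (- w t) \<le> k (- w y / d0) / c0"
      using assms t ab by (intro slope_le_pos) auto
    then show "- (k (- w y / d0) / c0) \<le> slope t (w t)" by (simp add: slope_minus)
  qed (use assms u_cont u_deriv in auto)
  then show ?thesis by simp
qed

text \<open>The flux decreases. If it is nonnegative at t, then u has climbed from a to t at least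
  at the slope belonging to w t, and after t it climbs at most \<open>\<kappa>\<close> times as
  fast; a point x before t is lower than t anyway. If the flux is negative at t, the mirrored
  argument starts from b, where \<open>0 \<le> u b\<close> replaces u a = 0.\<close>

lemma lower_bound:
  assumes ub: "0 \<le> u b" and t: "a < t" "t < b" and x: "x \<in> {a..b}"
  shows "u x * min (t - a) (b - t) \<le> (1 + \<kappa>) * u t"
proof -
  have tt: "t \<in> {0..1}" using t ab by auto
  have small: "u x * min (t - a) (b - t) \<le> (1 + \<kappa>) * u t" if "u x \<le> u t" "0 \<le> u t"
  proof -
    have "u x * min (t - a) (b - t) \<le> u t * min (t - a) (b - t)"
      using that t by (intro mult_right_mono) auto
    also have "\<dots> \<le> u t * 1"
      using that t ab by (intro mult_left_mono) auto
    also have "\<dots> \<le> (1 + \<kappa>) * u t" using that \<kappa>_nonneg by (simp add: algebra_simps)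
    finally show ?thesis .
  qed
  \<comment> \<open>Common form of both cases: L is the distance from t to the end from which the
    height of t is measured, M the distance from t to x on the other side.\<close>
  have main: "u x * min (t - a) (b - t) \<le> (1 + \<kappa>) * u t"
    if "0 \<le> S" "S * L \<le> u t" "u x - u t \<le> T * M" "T \<le> \<kappa> * S" "0 \<le> M" "L + M \<le> 1"
      and L: "L = t - a \<or> L = b - t" for S T L M
  proof (cases "u x \<le> u t")
    case True
    moreover have "0 \<le> S * L" using that t by auto
    ultimately show ?thesis using that by (intro small) linarith+
  next
    case False
    have L0: "0 \<le> L" using L t by auto
    have "0 \<le> S * L" using that L0 by simp
    then have ut: "0 \<le> u t" using that by linarith
    have "u x * min (t - a) (b - t) \<le> u x * L"
      using L False ut by (intro mult_left_mono) auto
    also have "\<dots> = (u t + (u x - u t)) * L" by simp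
    also have "\<dots> \<le> (1 + \<kappa>) * u t"
      using that L0 by (intro weighted_concavity) auto
    finally show ?thesis .
  qed
  show ?thesis
  proof (cases "0 \<le> w t")
    case True
    note W = this
    have S: "k (w t / d1) / c1 * (t - a) \<le> u t"
      using u_gain[of a t "w t"] t True u_start by auto
    have S0: "0 \<le> k (w t / d1) / c1" using True c1 d1 by (simp add: k_nonneg)
    then have "0 \<le> k (w t / d1) / c1 * (t - a)" using t by (intro mult_nonneg_nonneg) auto
    then have ut: "0 \<le> u t" using S by linarith
    show ?thesis
    proof (cases "x \<le> t")
      case True
      have "k (0 / d1) / c1 * (t - x) \<le> u t - u x"
        using True W t x by (intro u_gain) auto
      then show ?thesis
        using ut by (intro small) auto
    next
      case False
      then show ?thesis
        using x t ab True
        by (intro main[OF S0 S u_gain_le[of t x] slope_ratio]) auto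
    qed
  next
    case False
    then have W: "0 \<le> - w t" by simp
    have S: "k (- w t / d1) / c1 * (b - t) \<le> u t"
      using u_loss[of t b "- w t"] t False ub by auto
    have S0: "0 \<le> k (- w t / d1) / c1" using W c1 d1
      by (intro divide_nonneg_pos) (auto simp: k_nonneg divide_nonpos_pos)
    then have "0 \<le> k (- w t / d1) / c1 * (b - t)" using t by (intro mult_nonneg_nonneg) auto
    then have ut: "0 \<le> u t" using S by linarith
    show ?thesis
    proof (cases "t \<le> x")
      case True
      have "k (0 / d1) / c1 * (x - t) \<le> u t - u x"
        using True W t x by (intro u_loss) auto
      then show ?thesis
        using ut by (intro small) auto
    next
      case False
      then show ?thesis
        using x t ab W
        by (intro main[OF S0 S u_loss_le[of x t] slope_ratio]) auto
    qed
  qed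
qed

section \<open>Flux drop and height of the peak\<close>

lemma w_diff_le:
  assumes B: "\<And>t. t \<in> {a<..<b} \<Longrightarrow> F (u (max a (t - \<delta>))) \<le> B"
    and "a \<le> x" "x \<le> y" "y \<le> b"
  shows "w x - w y \<le> lam * B * (H y - H x)"
proof -
  have "- w y - - w x \<le> lam * B * H y - lam * B * H x"
  proof (rule diff_le_diff_of_deriv_le)
    fix t assume t: "x < t" "t < y"
    show "((\<lambda>t. - w t) has_real_derivative lam * (h t * F (u (max a (t - \<delta>))))) (at t)"
      using w_deriv[of t] t assms by (auto intro!: derivative_eq_intros)
    show "((\<lambda>t. lam * B * H t) has_real_derivative lam * B * h t) (at t)"
      using H_deriv[of t] t assms ab by (intro DERIV_cmult) auto
    have "h t * F (u (max a (t - \<delta>))) \<le> h t * B"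
      using B[of t] t assms ab h_nonneg[of t] by (intro mult_left_mono) auto
    then show "lam * (h t * F (u (max a (t - \<delta>)))) \<le> lam * B * h t"
      using lam by (metis mult.assoc mult.commute mult_left_mono)
  qed (use assms w_cont ab in \<open>auto intro!: continuous_intros continuous_on_subset[OF H_cont]\<close>)
  then show ?thesis by (simp add: algebra_simps)
qed

lemma w_diff_ge:
  assumes B: "\<And>t. x < t \<Longrightarrow> t < y \<Longrightarrow> B \<le> F (u (max a (t - \<delta>)))"
    and "a \<le> x" "x \<le> y" "y \<le> b"
  shows "lam * B * (H y - H x) \<le> w x - w y"
proof -
  have "lam * B * H y - lam * B * H x \<le> - w y - - w x"
  proof (rule diff_le_diff_of_deriv_le)
    fix t assume t: "x < t" "t < y"
    show "((\<lambda>t. - w t) has_real_derivative lam * (h t * F (u (max a (t - \<delta>))))) (at t)"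
      using w_deriv[of t] t assms by (auto intro!: derivative_eq_intros)
    show "((\<lambda>t. lam * B * H t) has_real_derivative lam * B * h t) (at t)"
      using H_deriv[of t] t assms ab by (intro DERIV_cmult) auto
    have "h t * B \<le> h t * F (u (max a (t - \<delta>)))"
      using B[of t] t assms ab h_nonneg[of t] by (intro mult_left_mono) auto
    then show "lam * B * h t \<le> lam * (h t * F (u (max a (t - \<delta>))))"
      using lam by (metis mult.assoc mult.commute mult_left_mono)
  qed (use assms w_cont ab in \<open>auto intro!: continuous_intros continuous_on_subset[OF H_cont]\<close>)
  then show ?thesis by (simp add: algebra_simps)
qed

text \<open>Since w vanishes at \<open>\<sigma>\<close> and H is nonpositive left of 1/2, the flux
  at t is at most lam * B * |H t|. By \<open>k_mult\<close> the factor lam * B / d0 can be pulled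
  out of k, leaving J |H t|, which is the derivative of P. The normalisation of H at 1/2 makes |H t|
  the inner integral in the integrability condition on h.\<close>

lemma peak_left:
  assumes B: "\<And>t. t \<in> {a<..<b} \<Longrightarrow> F (u (max a (t - \<delta>))) \<le> B"
    and \<sigma>: "a \<le> \<sigma>" "\<sigma> \<le> b" "\<sigma> \<le> 1/2" "w \<sigma> = 0"
  shows "u \<sigma> \<le> k (lam * B / d0) / c0 * (P \<sigma> - P a)"
proof -
  have B0: "0 \<le> B" using B[of "(a + b) / 2"] F_nonneg ab by (auto intro: order_trans)
  have "u \<sigma> - u a \<le> k (lam * B / d0) / c0 * P \<sigma> - k (lam * B / d0) / c0 * P a"
  proof (rule diff_le_diff_of_deriv_le)
    fix t assume t: "a < t" "t < \<sigma>"
    show "((\<lambda>t. k (lam * B / d0) / c0 * P t) has_real_derivative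
            k (lam * B / d0) / c0 * J \<bar>H t\<bar>) (at t)"
      using P_deriv[of t] t \<sigma> ab by (intro DERIV_cmult) auto
    have Ht: "H t \<le> 0" "H \<sigma> \<le> 0"
      using H_mono[of t "1/2"] H_mono[of \<sigma> "1/2"] H_half t \<sigma> ab by auto
    have "w t \<le> lam * B * (H \<sigma> - H t)" using w_diff_le[OF B, of t \<sigma>] t \<sigma> by auto
    also have "\<dots> \<le> lam * B * \<bar>H t\<bar>"
      using Ht lam B0 by (intro mult_left_mono) auto
    finally have "slope t (w t) \<le> k (lam * B * \<bar>H t\<bar> / d0) / c0"
      using t \<sigma> ab lam B0 by (intro slope_le_pos) auto
    also have "k (lam * B * \<bar>H t\<bar> / d0) = k ((lam * B / d0) * \<bar>H t\<bar>)" by simp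
    also have "\<dots> / c0 \<le> k (lam * B / d0) * J \<bar>H t\<bar> / c0"
      using k_mult[of "lam * B / d0" "\<bar>H t\<bar>"] lam B0 c0 d0 by (intro divide_right_mono) auto
    finally show "slope t (w t) \<le> k (lam * B / d0) / c0 * J \<bar>H t\<bar>" by simp
  next
    show "continuous_on {a..\<sigma>} (\<lambda>t. k (lam * B / d0) / c0 * P t)"
      using \<sigma> ab by (intro continuous_on_mult_left continuous_on_subset[OF P_cont]) auto
  qed (use \<sigma> ab u_cont u_deriv in auto)
  then show ?thesis using u_start by (simp add: right_diff_distrib)
qed

lemma peak_right:
  assumes B: "\<And>t. t \<in> {a<..<b} \<Longrightarrow> F (u (max a (t - \<delta>))) \<le> B"
    and \<sigma>: "a \<le> \<sigma>" "\<sigma> \<le> b" "1/2 \<le> \<sigma>" "w \<sigma> = 0"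
  shows "u \<sigma> - u b \<le> k (lam * B / d0) / c0 * (P b - P \<sigma>)"
proof -
  have B0: "0 \<le> B" using B[of "(a + b) / 2"] F_nonneg ab by (auto intro: order_trans)
  have "- u b - - u \<sigma> \<le> k (lam * B / d0) / c0 * P b - k (lam * B / d0) / c0 * P \<sigma>"
  proof (rule diff_le_diff_of_deriv_le)
    fix t assume t: "\<sigma> < t" "t < b"
    show "((\<lambda>t. - u t) has_real_derivative slope t (- w t)) (at t)"
      using u_deriv[of t] t \<sigma> by (auto intro!: derivative_eq_intros simp: slope_minus)
    show "((\<lambda>t. k (lam * B / d0) / c0 * P t) has_real_derivative
            k (lam * B / d0) / c0 * J \<bar>H t\<bar>) (at t)"
      using P_deriv[of t] t \<sigma> ab by (intro DERIV_cmult) auto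
    have Ht: "0 \<le> H t" "0 \<le> H \<sigma>"
      using H_mono[of "1/2" t] H_mono[of "1/2" \<sigma>] H_half t \<sigma> ab by auto
    have "- w t \<le> lam * B * (H t - H \<sigma>)" using w_diff_le[OF B, of \<sigma> t] t \<sigma> by auto
    also have "\<dots> \<le> lam * B * \<bar>H t\<bar>"
      using Ht lam B0 by (intro mult_left_mono) auto
    finally have "slope t (- w t) \<le> k (lam * B * \<bar>H t\<bar> / d0) / c0"
      using t \<sigma> ab lam B0 by (intro slope_le_pos) auto
    also have "k (lam * B * \<bar>H t\<bar> / d0) = k ((lam * B / d0) * \<bar>H t\<bar>)" by simp
    also have "\<dots> / c0 \<le> k (lam * B / d0) * J \<bar>H t\<bar> / c0"
      using k_mult[of "lam * B / d0" "\<bar>H t\<bar>"] lam B0 c0 d0 by (intro divide_right_mono) auto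
    finally show "slope t (- w t) \<le> k (lam * B / d0) / c0 * J \<bar>H t\<bar>" by simp
  next
    show "continuous_on {\<sigma>..b} (\<lambda>t. k (lam * B / d0) / c0 * P t)"
      using \<sigma> ab by (intro continuous_on_mult_left continuous_on_subset[OF P_cont]) auto
  qed (use \<sigma> ab u_cont in \<open>auto intro: continuous_on_minus\<close>)
  then show ?thesis by (simp add: right_diff_distrib)
qed

lemma w_zero_at_interior_max:
  assumes "a < \<sigma>" "\<sigma> < b" "\<And>t. t \<in> {a..b} \<Longrightarrow> u t \<le> u \<sigma>"
  shows "w \<sigma> = 0"
proof -
  have "slope \<sigma> (w \<sigma>) = 0"
  proof (rule DERIV_local_max[OF u_deriv, of \<sigma> "min (\<sigma> - a) (b - \<sigma>)"])
    show "\<forall>y. \<bar>\<sigma> - y\<bar> < min (\<sigma> - a) (b - \<sigma>) \<longrightarrow> u y \<le> u \<sigma>"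
      by (intro allI impI assms(3)) auto
  qed (use assms in auto)
  then have "k (w \<sigma> / d \<sigma>) = k 0"
    using c_pos[of \<sigma>] assms ab by (simp add: slope_def)
  then show ?thesis
    using d_pos[of \<sigma>] assms ab unfolding strict_mono_eq[OF k_mono] by simp
qed

end

end

subsection \<open>Solving the delayed initial value problem\<close>

text \<open>Substituting r = (t - a) * \<theta> + a moves the variable upper limit into the
  integrand, leaving an integral over the fixed interval [0, 1] with parameters s and t.\<close>

lemma continuous_on_indefinite_integral_param:
  fixes g :: "real \<Rightarrow> real \<Rightarrow> real"
  assumes g: "continuous_on (UNIV \<times> {a..b}) (\<lambda>(s, t). g s t)"
  shows "continuous_on (UNIV \<times> {a..b}) (\<lambda>(s, t). integral {a..t} (g s))"
proof -
  have "continuous_on ((UNIV \<times> {a..b}) \<times> cbox 0 1)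
          (\<lambda>(x, \<theta>). case x of (s, t) \<Rightarrow> g s ((t - a) * \<theta> + a))"
  proof -
    have *: "(t - a) * \<theta> + a \<le> b" if "a \<le> t" "t \<le> b" "0 \<le> \<theta>" "\<theta> \<le> 1" for t \<theta> :: real
      using that mult_left_mono[of \<theta> 1 "t - a"] by auto
    have "continuous_on ((UNIV \<times> {a..b}) \<times> cbox 0 1)
            (\<lambda>z. (\<lambda>(s, t). g s t) (fst (fst z), (snd (fst z) - a) * snd z + a))"
      by (rule continuous_on_compose2[OF g])
         (auto intro!: continuous_intros *)
    then show ?thesis by (simp add: case_prod_unfold)
  qed
  from integral_continuous_on_param[OF this]
  have "continuous_on (UNIV \<times> {a..b})
      (\<lambda>x. (snd x - a) * integral (cbox 0 1) (\<lambda>\<theta>. g (fst x) ((snd x - a) * \<theta> + a)))"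
    by (intro continuous_intros) (simp add: case_prod_unfold)
  moreover have "(snd x - a) * integral (cbox 0 1) (\<lambda>\<theta>. g (fst x) ((snd x - a) * \<theta> + a))
      = (case x of (s, t) \<Rightarrow> integral {a..t} (g s))" if "x \<in> UNIV \<times> {a..b}" for x
  \<comment> \<open>The substitution degenerates at t = a, where both sides are 0.\<close>
  proof (cases "snd x = a")
    case True
    then show ?thesis by (simp add: case_prod_unfold)
  next
    case False
    obtain s t where x: "x = (s, t)" by force
    have t: "a < t" "t \<le> b" using that False x by auto
    have "continuous_on {a..t} (\<lambda>r. (\<lambda>(s, t). g s t) (s, r))"
      by (rule continuous_on_compose2[OF g]) (use t in \<open>auto intro!: continuous_intros\<close>)
    then have "(g s has_integral integral {a..t} (g s)) (cbox a t)"
      by (simp add: integrable_continuous_interval integrable_integral)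
    from has_integral_affinity'[OF this, of "t - a" a]
    have "((\<lambda>\<theta>. g s ((t - a) * \<theta> + a)) has_integral integral {a..t} (g s) / (t - a)) (cbox 0 1)"
      using t by (simp add: divide_inverse_commute)
    then show ?thesis
      using t x by (simp add: integral_unique)
  qed
  ultimately show ?thesis
    by (subst (asm) continuous_on_cong[OF refl]) auto
qed

section \<open>The maximum of a trajectory as a function of the shooting parameter\<close>

lemma Sup_image_attained:
  fixes u :: "real \<Rightarrow> real"
  assumes "a \<le> b" "continuous_on {a..b} u"
  obtains \<sigma> where "\<sigma> \<in> {a..b}" "u \<sigma> = Sup (u ` {a..b})" "\<And>t. t \<in> {a..b} \<Longrightarrow> u t \<le> Sup (u ` {a..b})"
proof -
  from continuous_attains_sup[of "{a..b}" u] assms obtain \<sigma> where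
    \<sigma>: "\<sigma> \<in> {a..b}" "\<forall>t\<in>{a..b}. u t \<le> u \<sigma>" by auto
  then have "Sup (u ` {a..b}) = u \<sigma>"
    by (intro cSup_eq_maximum) auto
  then show thesis using \<sigma> that by auto
qed

text \<open>By uniform continuity on the compact rectangle, a maximiser for one parameter is nearly
  as good for any close parameter. This gives a one-sided estimate, used in both directions.\<close>

lemma continuous_on_Sup_param:
  fixes U :: "real \<Rightarrow> real \<Rightarrow> real"
  assumes U: "continuous_on (UNIV \<times> {a..b}) (\<lambda>(s, t). U s t)" and ab: "a \<le> b"
  shows "continuous_on {0..S} (\<lambda>s. Sup (U s ` {a..b}))"
proof -
  have cont: "continuous_on {a..b} (U s)" for s
  proof -
    have "continuous_on {a..b} (\<lambda>r. (\<lambda>(s, t). U s t) (s, r))"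
      by (rule continuous_on_compose2[OF U]) (auto intro!: continuous_intros)
    then show ?thesis by simp
  qed
  have "uniformly_continuous_on ({0..S} \<times> {a..b}) (\<lambda>(s, t). U s t)"
    by (intro compact_uniformly_continuous continuous_on_subset[OF U] compact_Times) auto
  then have uc: "\<exists>\<delta>>0. \<forall>x\<in>{0..S} \<times> {a..b}. \<forall>y\<in>{0..S} \<times> {a..b}.
      dist y x < \<delta> \<longrightarrow> dist ((\<lambda>(s, t). U s t) y) ((\<lambda>(s, t). U s t) x) < e" if "0 < e" for e
    using that unfolding uniformly_continuous_on_def by blast
  show ?thesis
    unfolding continuous_on_iff
  proof (intro ballI allI impI)
    fix s e :: real assume s: "s \<in> {0..S}" and e: "0 < e"
    from uc[OF e] obtain \<delta> where \<delta>: "0 < \<delta>"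
      and D: "\<And>x y. x \<in> {0..S} \<times> {a..b} \<Longrightarrow> y \<in> {0..S} \<times> {a..b} \<Longrightarrow> dist y x < \<delta> \<Longrightarrow>
        dist ((\<lambda>(s, t). U s t) y) ((\<lambda>(s, t). U s t) x) < e" by blast
    have half: "Sup (U x ` {a..b}) < Sup (U y ` {a..b}) + e"
      if "x \<in> {0..S}" "y \<in> {0..S}" "dist x y < \<delta>" for x y
    proof -
      from Sup_image_attained[OF ab cont] obtain \<sigma> where
        \<sigma>: "\<sigma> \<in> {a..b}" "U x \<sigma> = Sup (U x ` {a..b})" by blast
      have "dist (U x \<sigma>) (U y \<sigma>) < e"
        using D[of "(y, \<sigma>)" "(x, \<sigma>)"] that \<sigma> by (auto simp: dist_Pair_Pair)
      moreover have "U y \<sigma> \<le> Sup (U y ` {a..b})"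
        using Sup_image_attained[OF ab cont] \<sigma> by metis
      ultimately show ?thesis using \<sigma> by (auto simp: dist_real_def)
    qed
    show "\<exists>\<delta>>0. \<forall>x\<in>{0..S}. dist x s < \<delta> \<longrightarrow>
        dist (Sup (U x ` {a..b})) (Sup (U s ` {a..b})) < e"
    proof (intro exI conjI ballI impI)
      fix x assume "x \<in> {0..S}" "dist x s < \<delta>"
      then show "dist (Sup (U x ` {a..b})) (Sup (U s ` {a..b})) < e"
        using half[of x s] half[of s x] s by (auto simp: dist_real_def abs_less_iff)
    qed (rule \<delta>)
  qed
qed

text \<open>Take s2 as the first parameter where N equals hi, and s1 as the last one before s2 where
  N equals lo. Leaving the band in between would produce, by the intermediate value theorem, an
  earlier hi or a later lo.\<close>

lemma level_segment:
  fixes N :: "real \<Rightarrow> real"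
  assumes N: "continuous_on {0..S} N" and S: "0 \<le> S" "N 0 \<le> lo" "lo \<le> hi" "hi \<le> N S"
  obtains s1 s2 where "0 \<le> s1" "s1 \<le> s2" "s2 \<le> S" "N s1 = lo" "N s2 = hi"
    "\<And>s. s1 \<le> s \<Longrightarrow> s \<le> s2 \<Longrightarrow> lo \<le> N s \<and> N s \<le> hi"
proof -
  have level: "compact {s \<in> {0..T}. N s = y}" if "T \<le> S" for T y
  proof -
    have "closed ({0..T} \<inter> N -` {y})"
      using that by (intro continuous_closed_preimage continuous_on_subset[OF N]) auto
    moreover have "{s \<in> {0..T}. N s = y} = {0..T} \<inter> ({0..T} \<inter> N -` {y})" by auto
    ultimately show ?thesis by (metis compact_Icc compact_Int_closed)
  qed
  have "\<exists>s\<ge>0. s \<le> S \<and> N s = hi"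
    by (rule IVT') (use assms in auto)
  then obtain s2 where s2: "s2 \<in> {0..S}" "N s2 = hi"
    and s2_min: "\<And>s. s \<in> {0..S} \<Longrightarrow> N s = hi \<Longrightarrow> s2 \<le> s"
    using compact_attains_inf[OF level[of S hi]] by auto
  have "\<exists>s\<ge>0. s \<le> s2 \<and> N s = lo"
    by (rule IVT') (use assms s2 in \<open>auto intro: continuous_on_subset\<close>)
  then have "{s \<in> {0..s2}. N s = lo} \<noteq> {}" by auto
  moreover have "s2 \<le> S" using s2 by simp
  ultimately obtain s1 where s1: "s1 \<in> {0..s2}" "N s1 = lo"
    and s1_max: "\<And>s. s \<in> {0..s2} \<Longrightarrow> N s = lo \<Longrightarrow> s \<le> s1"
    using compact_attains_sup[OF level] by blast
  show thesis
  proof (rule that[of s1 s2])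
    fix s assume s: "s1 \<le> s" "s \<le> s2"
    show "lo \<le> N s \<and> N s \<le> hi"
    proof (intro conjI; rule ccontr)
      assume "\<not> lo \<le> N s"
      then have "\<exists>x\<ge>s. x \<le> s2 \<and> N x = lo"
        by (intro IVT') (use assms s s1 s2 in \<open>auto intro: continuous_on_subset\<close>)
      then obtain x where "x \<ge> s" "x \<le> s2" "N x = lo" by blast
      with s1_max[of x] s s1 \<open>\<not> lo \<le> N s\<close> show False by (cases "x = s") auto
    next
      assume "\<not> N s \<le> hi"
      then have "\<exists>x\<ge>0. x \<le> s \<and> N x = hi"
        by (intro IVT') (use assms s s1 s2 in \<open>auto intro: continuous_on_subset\<close>)
      then obtain x where "x \<ge> 0" "x \<le> s" "N x = hi" by blast
      with s2_min[of x] s s1 s2 \<open>\<not> N s \<le> hi\<close> show False by (cases "x = s") auto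
    qed
  qed (use s1 s2 in auto)
qed

text \<open>A sign change of g on all of [0, S] would give a zero without control of N there;
  confining the search to a segment on which N stays between the two levels supplies that
  control.\<close>

lemma zero_between_levels:
  fixes N g :: "real \<Rightarrow> real"
  assumes N: "continuous_on {0..S} N" and g: "continuous_on {0..S} g"
    and S: "0 \<le> S" "N 0 \<le> min p q" "max p q \<le> N S"
    and p: "\<And>s. s \<in> {0..S} \<Longrightarrow> N s = p \<Longrightarrow> 0 < g s"
    and q: "\<And>s. s \<in> {0..S} \<Longrightarrow> N s = q \<Longrightarrow> g s < 0"
  obtains s where "s \<in> {0..S}" "g s = 0" "min p q \<le> N s" "N s \<le> max p q"
proof -
  have le: "min p q \<le> max p q" by simp
  obtain s1 s2 where
    s: "0 \<le> s1" "s1 \<le> s2" "s2 \<le> S" "N s1 = min p q" "N s2 = max p q"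
    "\<And>s. s1 \<le> s \<Longrightarrow> s \<le> s2 \<Longrightarrow> min p q \<le> N s \<and> N s \<le> max p q"
    using level_segment[OF N S(1,2) le S(3)] by metis
  have gc: "continuous_on {s1..s2} g" using s by (auto intro: continuous_on_subset[OF g])
  have "\<exists>s. s1 \<le> s \<and> s \<le> s2 \<and> g s = 0"
  proof (cases "p \<le> q")
    case True
    then have "0 < g s1" "g s2 < 0" using s p[of s1] q[of s2] by auto
    then show ?thesis using IVT2'[of g s2 0 s1] gc s by auto
  next
    case False
    then have "g s1 < 0" "0 < g s2" using s q[of s1] p[of s2] by auto
    then show ?thesis using IVT'[of g s1 0 s2] gc s by auto
  qed
  then obtain s' where "s1 \<le> s'" "s' \<le> s2" "g s' = 0" by blast
  then show thesis using that[of s'] s by auto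
qed

context phi_bvp
begin

text \<open>
  Because of the delay, the j-th iterate is already exact on \<open>[a, a + j \<delta>]\<close>, so the iteration becomes
  stationary on \<open>[a, b]\<close> after finitely many steps.
\<close>

definition flux :: "real \<Rightarrow> real \<Rightarrow> real \<Rightarrow> (real \<Rightarrow> real \<Rightarrow> real) \<Rightarrow> real \<Rightarrow> real \<Rightarrow> real" where
  "flux lam \<delta> a v s t = s - lam * integral {a..t} (\<lambda>r. h r * F (v s (max a (r - \<delta>))))"

primrec picard :: "real \<Rightarrow> real \<Rightarrow> real \<Rightarrow> nat \<Rightarrow> real \<Rightarrow> real \<Rightarrow> real" where
  "picard lam \<delta> a 0 s t = 0"
| "picard lam \<delta> a (Suc j) s t = integral {a..t} (\<lambda>r. slope r (flux lam \<delta> a (picard lam \<delta> a j) s r))"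

context
  fixes lam \<delta> a b :: real
  assumes \<delta>: "0 < \<delta>" and ab: "0 < a" "a < b" "b < 1"
begin

lemma integrand_cont:
  assumes v: "continuous_on (UNIV \<times> {a..b}) (\<lambda>(s, t). v s t)"
  shows "continuous_on (UNIV \<times> {a..b}) (\<lambda>(s, r). h r * F (v s (max a (r - \<delta>))))"
proof -
  have "continuous_on (UNIV \<times> {a..b}) (\<lambda>z. (\<lambda>(s, t). v s t) (fst z, max a (snd z - \<delta>)))"
    by (rule continuous_on_compose2[OF v]) (use ab \<delta> in \<open>auto intro!: continuous_intros\<close>)
  then have "continuous_on (UNIV \<times> {a..b}) (\<lambda>z. F (v (fst z) (max a (snd z - \<delta>))))"
    by (intro continuous_on_compose2[OF F_cont]) auto
  moreover have "continuous_on (UNIV \<times> {a..b}) (\<lambda>z. h (snd z))"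
    by (rule continuous_on_compose2[OF h_cont]) (use ab in \<open>auto intro!: continuous_intros\<close>)
  ultimately show ?thesis
    unfolding case_prod_unfold by (intro continuous_on_mult)
qed

lemma flux_cont:
  assumes v: "continuous_on (UNIV \<times> {a..b}) (\<lambda>(s, t). v s t)"
  shows "continuous_on (UNIV \<times> {a..b}) (\<lambda>(s, t). flux lam \<delta> a v s t)"
proof -
  have "continuous_on (UNIV \<times> {a..b})
      (\<lambda>z. fst z - lam * (case z of (s, t) \<Rightarrow> integral {a..t} (\<lambda>r. h r * F (v s (max a (r - \<delta>))))))"
    by (intro continuous_intros continuous_on_indefinite_integral_param integrand_cont[OF v])
  then show ?thesis by (simp add: flux_def case_prod_unfold)
qed

lemma slope_flux_cont:
  assumes v: "continuous_on (UNIV \<times> {a..b}) (\<lambda>(s, t). v s t)"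
  shows "continuous_on (UNIV \<times> {a..b}) (\<lambda>(s, t). slope t (flux lam \<delta> a v s t))"
proof -
  have pos: "c t \<noteq> 0" "d t \<noteq> 0" if "t \<in> {a..b}" for t
    using c_pos[of t] d_pos[of t] that ab by auto
  have "continuous_on (UNIV \<times> {a..b}) (\<lambda>z::real \<times> real. c (snd z))"
    "continuous_on (UNIV \<times> {a..b}) (\<lambda>z::real \<times> real. d (snd z))"
    by (rule continuous_on_compose2[OF c_cont] continuous_on_compose2[OF d_cont];
        use ab in \<open>auto intro!: continuous_intros\<close>)+
  then have "continuous_on (UNIV \<times> {a..b})
      (\<lambda>z. k ((case z of (s, t) \<Rightarrow> flux lam \<delta> a v s t) / d (snd z)) / c (snd z))"
    using pos
    by (intro continuous_on_divide continuous_on_compose2[OF k_cont] flux_cont[OF v]) auto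
  then show ?thesis by (simp add: slope_def case_prod_unfold)
qed

lemma picard_cont: "continuous_on (UNIV \<times> {a..b}) (\<lambda>(s, t). picard lam \<delta> a j s t)"
proof (induction j)
  case 0
  then show ?case by (simp add: case_prod_unfold)
next
  case (Suc j)
  show ?case
    unfolding picard.simps
    by (rule continuous_on_indefinite_integral_param[OF slope_flux_cont[OF Suc]])
qed

lemma picard_stable:
  "t \<in> {a..b} \<Longrightarrow> t \<le> a + real j * \<delta> \<Longrightarrow> picard lam \<delta> a (Suc j) s t = picard lam \<delta> a j s t"
proof (induction j arbitrary: t)
  case 0
  then show ?case by simp
next
  case (Suc j)
  have fl: "flux lam \<delta> a (picard lam \<delta> a (Suc j)) s r = flux lam \<delta> a (picard lam \<delta> a j) s r"
    if "r \<in> {a..t}" for r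
  proof -
    \<comment> \<open>The flux at r reads the iterate only at points set back by
      \<open>\<delta>\<close> or clamped to a, which lie in the range of the induction
      hypothesis.\<close>
    have "picard lam \<delta> a (Suc j) s (max a (x - \<delta>)) = picard lam \<delta> a j s (max a (x - \<delta>))"
      if "x \<in> {a..r}" for x
      using that \<open>r \<in> {a..t}\<close> Suc.prems \<delta> ab
      by (intro Suc.IH) (auto simp: algebra_simps)
    then show ?thesis
      unfolding flux_def by (auto intro!: arg_cong2[where f="(*)"] Henstock_Kurzweil_Integration.integral_cong)
  qed
  show ?case
    unfolding picard.simps(2)[of _ _ _ "Suc j"] picard.simps(2)[of _ _ _ j]
    by (rule Henstock_Kurzweil_Integration.integral_cong)
       (use fl in \<open>simp add: picard.simps(2)[abs_def]\<close>)
qed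

lemma delayed_sol_exists:
  obtains U W where "\<And>s. delayed_sol lam \<delta> a b (U s) (W s)" "\<And>s. W s a = s"
    "continuous_on (UNIV \<times> {a..b}) (\<lambda>(s, t). U s t)"
proof -
  obtain j :: nat where j: "(b - a) / \<delta> \<le> real j" using real_arch_simple by blast
  then have ja: "b \<le> a + real j * \<delta>" using \<delta> by (simp add: field_simps)
  define v where "v = picard lam \<delta> a j"
  define U where "U = picard lam \<delta> a (Suc j)"
  define W where "W = flux lam \<delta> a v"
  \<comment> \<open>The steps of length \<open>\<delta>\<close> cover [a, b] after j rounds, so the
    last two iterates agree there and U solves the equation with itself in the delayed term.\<close>
  have Uv: "U s t = v s t" if "t \<in> {a..b}" for s t
    unfolding U_def v_def using that ja by (intro picard_stable) auto
  have slice: "continuous_on {a..b} (g s)" if "continuous_on (UNIV \<times> {a..b}) (\<lambda>(s, t). g s t)"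
    for g :: "real \<Rightarrow> real \<Rightarrow> real" and s
  proof -
    have "continuous_on {a..b} (\<lambda>r. (\<lambda>(s, t). g s t) (s, r))"
      by (rule continuous_on_compose2[OF that]) (auto intro!: continuous_intros)
    then show ?thesis by simp
  qed
  have vc: "continuous_on (UNIV \<times> {a..b}) (\<lambda>(s, t). v s t)"
    unfolding v_def by (rule picard_cont)
  have Uc: "continuous_on (UNIV \<times> {a..b}) (\<lambda>(s, t). U s t)"
    unfolding U_def by (rule picard_cont)
  show thesis
  proof (rule that[OF _ _ Uc])
    fix s
    show "W s a = s" by (simp add: W_def flux_def)
    show "delayed_sol lam \<delta> a b (U s) (W s)"
      unfolding delayed_sol_def
    proof (intro conjI ballI)
      show "continuous_on {a..b} (U s)" by (rule slice[OF Uc])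
      show "continuous_on {a..b} (W s)" unfolding W_def by (rule slice[OF flux_cont[OF vc]])
      show "U s a = 0" by (simp add: U_def)
    next
      fix t assume t: "t \<in> {a<..<b}"
      then have at: "at t within {a..b} = at t" by (simp add: at_within_Icc_at)
      have "((\<lambda>x. integral {a..x} (\<lambda>r. slope r (W s r))) has_real_derivative slope t (W s t))
              (at t within {a..b})"
        unfolding W_def using t
        by (intro integral_has_real_derivative slice[OF slope_flux_cont[OF vc]]) auto
      then show "(U s has_real_derivative slope t (W s t)) (at t)"
        unfolding at by (simp add: U_def W_def v_def[symmetric] picard.simps(2)[abs_def])
      have "((\<lambda>x. integral {a..x} (\<lambda>r. h r * F (v s (max a (r - \<delta>))))) has_real_derivative
              h t * F (v s (max a (t - \<delta>)))) (at t within {a..b})"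
        using t by (intro integral_has_real_derivative slice[OF integrand_cont[OF vc]]) auto
      then have "(W s has_real_derivative 0 - lam * (h t * F (v s (max a (t - \<delta>))))) (at t)"
        unfolding at W_def flux_def[abs_def] by (intro DERIV_diff DERIV_cmult DERIV_const)
      moreover have "v s (max a (t - \<delta>)) = U s (max a (t - \<delta>))"
        using t \<delta> by (intro Uv[symmetric]) auto
      ultimately show "(W s has_real_derivative - (lam * (h t * F (U s (max a (t - \<delta>)))))) (at t)"
        by simp
    qed
  qed
qed

end

end

subsection \<open>Shooting\<close>

context phi_bvp
begin

text \<open>The bound must hold on the whole half-line below Q, because trajectories of the shooting
  may become negative.\<close>

lemma F_bounded_above:
  assumes F_neg: "\<And>x. x \<le> 0 \<Longrightarrow> F x = F 0"
  obtains B where "0 \<le> B" "\<And>x. x \<le> Q \<Longrightarrow> F x \<le> B"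
proof -
  have "\<exists>x\<in>{0..max 0 Q}. \<forall>y\<in>{0..max 0 Q}. F y \<le> F x"
    by (rule continuous_attains_sup) (auto intro: continuous_on_subset[OF F_cont])
  then obtain x where x: "\<forall>y\<in>{0..max 0 Q}. F y \<le> F x" by blast
  show thesis
  proof (rule that[of "F x"])
    fix y assume "y \<le> Q"
    then show "F y \<le> F x"
      using x F_neg[of y] by (cases "y \<le> 0") auto
  qed (rule F_nonneg)
qed

text \<open>If u b were not positive, the maximum p would be interior and the flux would vanish
  there. The peak estimates, from the left or from the right according to the side of 1/2, would
  then bound p by a quantity smaller than p.\<close>

lemma contraction_at_level:
  assumes sol: "delayed_sol lam \<delta> a b u w" and lam: "0 \<le> lam" and ab: "0 < a" "a < b" "b < 1"
    and \<delta>: "0 < \<delta>"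
    and p: "0 < p" "\<And>t. t \<in> {a..b} \<Longrightarrow> u t \<le> p" "\<sigma> \<in> {a..b}" "u \<sigma> = p"
    and B: "\<And>x. x \<le> p \<Longrightarrow> F x \<le> B" "k (lam * B / d0) / c0 * (P 1 - P 0) < p"
  shows "0 < u b"
proof (rule ccontr)
  assume ub: "\<not> 0 < u b"
  have "\<sigma> \<noteq> a" "\<sigma> \<noteq> b"
    using p ub u_start[OF sol lam ab] by auto
  then have \<sigma>: "a < \<sigma>" "\<sigma> < b" using p(3) by auto
  have w: "w \<sigma> = 0"
    using w_zero_at_interior_max[OF sol lam ab \<sigma>] p by auto
  have FB: "F (u (max a (t - \<delta>))) \<le> B" if "t \<in> {a<..<b}" for t
    using that \<delta> by (intro B p) auto
  have "0 \<le> B" using B(1)[of 0] F_nonneg[of 0] p by simp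
  then have K: "0 \<le> k (lam * B / d0) / c0"
    using lam c0 d0 by (simp add: k_nonneg)
  have "p \<le> k (lam * B / d0) / c0 * (P 1 - P 0)"
  proof (cases "\<sigma> \<le> 1/2")
    case True
    have "p \<le> k (lam * B / d0) / c0 * (P \<sigma> - P a)"
      using peak_left[OF sol lam ab FB _ _ True w] \<sigma> p by auto
    also have "\<dots> \<le> k (lam * B / d0) / c0 * (P 1 - P 0)"
      using P_mono[of \<sigma> 1] P_mono[of 0 a] \<sigma> ab by (intro mult_left_mono[OF _ K]) auto
    finally show ?thesis .
  next
    case False
    have "p \<le> k (lam * B / d0) / c0 * (P b - P \<sigma>)"
      using peak_right[OF sol lam ab FB _ _ _ w] \<sigma> p False ub by auto
    also have "\<dots> \<le> k (lam * B / d0) / c0 * (P 1 - P 0)"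
      using P_mono[of b 1] P_mono[of 0 \<sigma>] \<sigma> ab by (intro mult_left_mono[OF _ K]) auto
    finally show ?thesis .
  qed
  then show False using B by simp
qed

text \<open>If u b were nonnegative, \<open>lower_bound\<close> would keep u above q * \<eta> / (1 +
  \<kappa>) in the middle, so F is at least \<open>\<mu>\<close> there and the flux drops by at
  least 2 * W between \<open>\<gamma>1\<close> and \<open>\<gamma>2\<close>. Hence the flux is at
  least W up to \<open>\<gamma>1\<close> or at most -W from \<open>\<gamma>2\<close> on, and u would
  climb, or fall, by more than its maximum q over a length of at least
  \<open>\<eta>\<close>.\<close>

lemma expansion_at_level:
  assumes sol: "delayed_sol lam \<delta> a b u w" and lam: "0 \<le> lam" and ab: "0 < a" "a < b" "b < 1"
    and \<eta>: "0 < \<eta>" "2 * \<eta> \<le> \<gamma>1" "\<gamma>1 < \<gamma>2" "\<gamma>2 \<le> 1 - 2 * \<eta>" and \<gamma>: "2 * \<eta> \<le> \<gamma>1 - a" "a \<le> \<eta>" "1 - \<eta> \<le> b"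
    and \<delta>: "0 < \<delta>" "\<delta> \<le> \<eta>"
    and q: "0 < q" "\<And>t. t \<in> {a..b} \<Longrightarrow> u t \<le> q" "\<sigma> \<in> {a..b}" "u \<sigma> = q"
    and \<mu>: "0 \<le> \<mu>" "\<And>x. q * \<eta> / (1 + \<kappa>) \<le> x \<Longrightarrow> x \<le> q \<Longrightarrow> \<mu> \<le> F x"
    and large: "q < k (lam * \<mu> * (H \<gamma>2 - H \<gamma>1) / 2 / d1) / c1 * \<eta>"
  shows "u b < 0"
proof (rule ccontr)
  assume "\<not> u b < 0"
  then have ub: "0 \<le> u b" by simp
  define W where "W = lam * \<mu> * (H \<gamma>2 - H \<gamma>1) / 2"
  have "0 \<le> H \<gamma>2 - H \<gamma>1" using H_mono[of \<gamma>1 \<gamma>2] \<eta> by auto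
  then have W0: "0 \<le> W" using lam \<mu> by (simp add: W_def)
  \<comment> \<open>The range starts at \<open>\<gamma>1 - \<eta>\<close> because the delay, at most
    \<open>\<eta>\<close>, reads u to the left of \<open>\<gamma>1\<close>.\<close>
  have lb: "q * \<eta> / (1 + \<kappa>) \<le> u t" if "\<gamma>1 - \<eta> \<le> t" "t \<le> \<gamma>2" for t
  proof -
    have t: "a < t" "t < b" using that \<eta> \<gamma> by auto
    have "q * \<eta> \<le> q * min (t - a) (b - t)"
      using q that \<eta> \<gamma> by (intro mult_left_mono) auto
    also have "\<dots> \<le> (1 + \<kappa>) * u t"
      using lower_bound[OF sol lam ab ub t q(3)] q by simp
    finally show ?thesis using \<kappa>_nonneg by (simp add: field_simps)
  qed
  have "lam * \<mu> * (H \<gamma>2 - H \<gamma>1) \<le> w \<gamma>1 - w \<gamma>2"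
  proof (rule w_diff_ge[OF sol lam ab])
    fix t assume t: "\<gamma>1 < t" "t < \<gamma>2"
    then have "max a (t - \<delta>) = t - \<delta>" using \<delta> \<gamma> \<eta> by auto
    then show "\<mu> \<le> F (u (max a (t - \<delta>)))"
      using t \<delta> \<gamma> \<eta> by (auto intro!: \<mu> lb q)
  qed (use \<eta> \<gamma> in auto)
  then have "W \<le> w \<gamma>1 \<or> W \<le> - w \<gamma>2" unfolding W_def by linarith
  then show False
  proof
    assume w: "W \<le> w \<gamma>1"
    have "k (W / d1) / c1 * \<eta> \<le> k (W / d1) / c1 * (\<gamma>1 - a)"
      using \<eta> \<gamma> W0 c1 d1 by (intro mult_left_mono divide_nonneg_pos) (auto simp: k_nonneg)
    also have "\<dots> \<le> u \<gamma>1 - u a"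
      using u_gain[OF sol lam ab, of a \<gamma>1 W] w W0 \<eta> \<gamma> by auto
    also have "\<dots> \<le> q" using q(2)[of \<gamma>1] \<eta> \<gamma> u_start[OF sol lam ab] by auto
    finally show False using large by (simp add: W_def)
  next
    assume w: "W \<le> - w \<gamma>2"
    have "k (W / d1) / c1 * \<eta> \<le> k (W / d1) / c1 * (b - \<gamma>2)"
      using \<eta> \<gamma> W0 c1 d1 by (intro mult_left_mono divide_nonneg_pos) (auto simp: k_nonneg)
    also have "\<dots> \<le> u \<gamma>2 - u b"
      using u_loss[OF sol lam ab, of \<gamma>2 b W] w W0 \<eta> \<gamma> by auto
    also have "\<dots> \<le> q" using q(2)[of \<gamma>2] \<eta> \<gamma> ub by auto
    finally show False using large by (simp add: W_def)
  qed
qed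

text \<open>Besides the boundary value, the peak \<open>\<sigma>\<close> with
  \<open>w \<sigma> = 0\<close> is returned: the compactness argument needs an interior zero of the
  flux.\<close>

lemma delayed_boundary_solution:
  assumes F_neg: "\<And>x. x \<le> 0 \<Longrightarrow> F x = F 0"
    and lam: "0 \<le> lam" and ab: "0 < a" "a < b" "b < 1" and \<delta>: "0 < \<delta>" "\<delta> \<le> \<eta>"
    and p: "0 < p" "\<And>x. x \<le> p \<Longrightarrow> F x \<le> B" "k (lam * B / d0) / c0 * (P 1 - P 0) < p"
    and \<eta>: "0 < \<eta>" "2 * \<eta> \<le> \<gamma>1" "\<gamma>1 < \<gamma>2" "\<gamma>2 \<le> 1 - 2 * \<eta>" and \<gamma>: "2 * \<eta> \<le> \<gamma>1 - a" "a \<le> \<eta>" "1 - \<eta> \<le> b"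
    and q: "0 < q" "0 \<le> \<mu>" "\<And>x. q * \<eta> / (1 + \<kappa>) \<le> x \<Longrightarrow> x \<le> q \<Longrightarrow> \<mu> \<le> F x"
      "q < k (lam * \<mu> * (H \<gamma>2 - H \<gamma>1) / 2 / d1) / c1 * \<eta>"
  obtains u w \<sigma> where "delayed_sol lam \<delta> a b u w" "u b = 0" "\<sigma> \<in> {a<..<b}" "w \<sigma> = 0"
    "min p q \<le> u \<sigma>" "u \<sigma> \<le> max p q" "\<And>t. t \<in> {a..b} \<Longrightarrow> u t \<le> u \<sigma>"
proof -
  obtain U W where sol: "\<And>s. delayed_sol lam \<delta> a b (U s) (W s)" and W0: "\<And>s. W s a = s"
    and Uc: "continuous_on (UNIV \<times> {a..b}) (\<lambda>(s, t). U s t)"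
    using delayed_sol_exists[OF \<delta>(1) ab] by metis
  define N where "N = (\<lambda>s. Sup (U s ` {a..b}))"
  have Uscont: "continuous_on {a..b} (U s)" for s
    using sol[of s] by (simp add: delayed_sol_def)
  have peak: "\<exists>\<sigma>\<in>{a..b}. U s \<sigma> = N s" for s
    using Sup_image_attained[OF less_imp_le[OF ab(2)] Uscont[of s]] unfolding N_def by metis
  have le_N: "U s t \<le> N s" if "t \<in> {a..b}" for s t
    using Sup_image_attained[OF less_imp_le[OF ab(2)] Uscont[of s]] that unfolding N_def by metis
  obtain M where M: "0 \<le> M" "\<And>x. x \<le> max p q \<Longrightarrow> F x \<le> M"
    using F_bounded_above[OF F_neg] by metis
  obtain y where y: "0 \<le> y" "max p q * c1 / (b - a) \<le> k y" using k_unbounded by blast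
  define V where "V = y * d1"
  have V: "0 \<le> V" "max p q \<le> k (V / d1) / c1 * (b - a)"
    using y d1 c1 ab by (auto simp: V_def pos_divide_le_eq pos_le_divide_eq mult.commute simp del: max_less_iff_conj max.bounded_iff)
  \<comment> \<open>The first summand is the largest possible loss of flux while u stays below
    \<open>max p q\<close>. Starting with flux S therefore leaves at least V up to b, and V is
    chosen to lift u to \<open>max p q\<close>.\<close>
  define S where "S = lam * M * (H b - H a) + V"
  have S0: "0 \<le> S" using lam M V H_mono[of a b] ab by (simp add: S_def)
  have NS: "max p q \<le> N S"
  proof (rule ccontr)
    assume "\<not> max p q \<le> N S"
    then have small: "U S t \<le> max p q" if "t \<in> {a..b}" for t
      using le_N[OF that, of S] by auto
    have "W S a - W S b \<le> lam * M * (H b - H a)"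
      using \<delta> ab by (intro w_diff_le[OF sol lam ab]) (auto intro!: M small)
    then have "V \<le> W S b" using W0[of S] by (simp add: S_def)
    then have "max p q \<le> U S b - U S a"
      using u_gain[OF sol lam ab, of a b V S] V ab by auto
    then show False
      using le_N[of b S] ab u_start[OF sol lam ab, of S] \<open>\<not> max p q \<le> N S\<close> by auto
  qed
  \<comment> \<open>With initial flux 0 the flux is never positive, so u stays at or below
    0.\<close>
  have N0: "N 0 \<le> min p q"
  proof -
    obtain \<sigma> where \<sigma>: "\<sigma> \<in> {a..b}" "U 0 \<sigma> = N 0" using peak by blast
    have "k (0 / d1) / c1 * (\<sigma> - a) \<le> U 0 a - U 0 \<sigma>"
      using \<sigma> W0[of 0] by (intro u_loss[OF sol lam ab]) auto
    then show ?thesis using \<sigma> u_start[OF sol lam ab, of 0] p q by auto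
  qed
  have "continuous_on {0..S} (\<lambda>s. (\<lambda>(s, t). U s t) (s, b))"
    by (rule continuous_on_compose2[OF Uc]) (use ab in \<open>auto intro!: continuous_intros\<close>)
  then have gc: "continuous_on {0..S} (\<lambda>s. U s b)" by simp
  have Nc: "continuous_on {0..S} N"
    unfolding N_def using ab by (intro continuous_on_Sup_param[OF Uc]) auto
  have pos: "0 < U s b" if "N s = p" for s
  proof -
    obtain \<sigma> where \<sigma>: "\<sigma> \<in> {a..b}" "U s \<sigma> = N s" using peak by blast
    show ?thesis
      by (rule contraction_at_level[OF sol lam ab \<delta>(1) p(1) _ \<sigma>(1) _ p(2,3)])
         (use le_N[of _ s] \<sigma> that in auto)
  qed
  have neg: "U s b < 0" if "N s = q" for s
  proof -
    obtain \<sigma> where \<sigma>: "\<sigma> \<in> {a..b}" "U s \<sigma> = N s" using peak by blast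
    show ?thesis
      by (rule expansion_at_level[OF sol lam ab \<eta> \<gamma> \<delta> q(1) _ \<sigma>(1) _ q(2,3,4)])
         (use le_N[of _ s] \<sigma> that in auto)
  qed
  obtain s where s: "U s b = 0" "min p q \<le> N s" "N s \<le> max p q"
    using zero_between_levels[OF Nc gc S0 N0 NS pos neg] by auto
  obtain \<sigma> where \<sigma>: "\<sigma> \<in> {a..b}" "U s \<sigma> = N s" using peak by blast
  have "\<sigma> \<noteq> a" "\<sigma> \<noteq> b" using s \<sigma> u_start[OF sol lam ab, of s] p q by auto
  then have \<sigma>': "\<sigma> \<in> {a<..<b}" using \<sigma> by auto
  show thesis
  proof (rule that[OF sol[of s] s(1) \<sigma>'])
    show "W s \<sigma> = 0"
      using \<sigma>' \<sigma> le_N[of _ s] by (intro w_zero_at_interior_max[OF sol lam ab]) auto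
  qed (use s \<sigma> le_N in auto)
qed

end

subsection \<open>Compactness\<close>

text \<open>Continuity of \<open>\<Phi>\<close> suffices: once g n is within 1 of the bounded limit
  l, all arguments lie in a compact set, on which \<open>\<Phi>\<close> is uniformly
  continuous.\<close>

lemma uniform_limit_superposition:
  fixes \<Phi> :: "real \<Rightarrow> real \<Rightarrow> real"
  assumes A: "compact A" and \<Phi>: "continuous_on (A \<times> UNIV) (\<lambda>(t, x). \<Phi> t x)"
    and g: "uniform_limit A g l F" and l: "continuous_on A l"
  shows "uniform_limit A (\<lambda>n t. \<Phi> t (g n t)) (\<lambda>t. \<Phi> t (l t)) F"
proof -
  have "bounded (l ` A)" using A l by (simp add: compact_continuous_image compact_imp_bounded)
  then obtain R where R: "\<And>t. t \<in> A \<Longrightarrow> \<bar>l t\<bar> \<le> R"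
    by (auto simp: bounded_iff)
  have "uniformly_continuous_on (A \<times> {-(R+1)..R+1}) (\<lambda>(t, x). \<Phi> t x)"
    by (intro compact_uniformly_continuous continuous_on_subset[OF \<Phi>] compact_Times A) auto
  note uc = this[unfolded uniformly_continuous_on_def, rule_format]
  show ?thesis
    unfolding uniform_limit_iff
  proof (intro allI impI)
    fix e :: real assume "0 < e"
    from uc[OF this] obtain \<delta> where \<delta>: "0 < \<delta>"
      and D: "\<And>x y. x \<in> A \<times> {-(R+1)..R+1} \<Longrightarrow> y \<in> A \<times> {-(R+1)..R+1} \<Longrightarrow> dist y x < \<delta> \<Longrightarrow>
        dist ((\<lambda>(t, x). \<Phi> t x) y) ((\<lambda>(t, x). \<Phi> t x) x) < e" by blast
    have "\<forall>\<^sub>F n in F. \<forall>t\<in>A. dist (g n t) (l t) < min \<delta> 1"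
      by (rule uniform_limitD[OF g]) (use \<delta> in simp)
    then show "\<forall>\<^sub>F n in F. \<forall>t\<in>A. dist (\<Phi> t (g n t)) (\<Phi> t (l t)) < e"
    proof eventually_elim
      case (elim n)
      show ?case
      proof
        fix t assume t: "t \<in> A"
        have dl: "dist (g n t) (l t) < \<delta>" "\<bar>g n t - l t\<bar> < 1"
          using elim t by (auto simp: dist_real_def)
        then have "l t \<in> {-(R+1)..R+1}" "g n t \<in> {-(R+1)..R+1}"
          using R[OF t] unfolding atLeastAtMost_iff by linarith+
        with dl D[of "(t, l t)" "(t, g n t)"] t
        show "dist (\<Phi> t (g n t)) (\<Phi> t (l t)) < e"
          by (auto simp: dist_Pair_Pair)
      qed
    qed
  qed
qed

text \<open>The mean value inequality carries closeness from one point to the whole interval. The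
  anchor x n may move with n, as the peaks do.\<close>

lemma uniform_limit_antiderivative:
  fixes f f' :: "nat \<Rightarrow> real \<Rightarrow> real"
  assumes f': "uniform_limit {\<alpha>..\<beta>} f' g' sequentially"
    and f: "\<forall>\<^sub>F n in sequentially. \<forall>t\<in>{\<alpha>..\<beta>}. (f n has_real_derivative f' n t) (at t)"
    and G: "\<And>t. t \<in> {\<alpha>..\<beta>} \<Longrightarrow> (G has_real_derivative g' t) (at t)"
    and x: "\<And>n. x n \<in> {\<alpha>..\<beta>}" "(\<lambda>n. f n (x n) - G (x n)) \<longlonglongrightarrow> 0"
  shows "uniform_limit {\<alpha>..\<beta>} f G sequentially"
  unfolding uniform_limit_iff
proof (intro allI impI)
  fix e :: real assume e: "0 < e"
  have ab: "\<alpha> \<le> \<beta>" using x(1)[of 0] by auto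
  \<comment> \<open>Adding 1 to the length avoids a zero denominator when the interval is a
    point.\<close>
  define e' where "e' = e / 2 / (\<beta> - \<alpha> + 1)"
  have e': "0 < e'" using e ab by (simp add: e'_def)
  have e'_le: "e' * (\<beta> - \<alpha>) \<le> e / 2"
    using e ab by (simp add: e'_def field_simps)
  have "\<forall>\<^sub>F n in sequentially. \<forall>t\<in>{\<alpha>..\<beta>}. dist (f' n t) (g' t) < e'"
    using f' e' unfolding uniform_limit_iff by simp
  moreover have "\<forall>\<^sub>F n in sequentially. dist (f n (x n) - G (x n)) 0 < e / 2"
    using x(2) e by (intro tendstoD) auto
  ultimately show "\<forall>\<^sub>F n in sequentially. \<forall>t\<in>{\<alpha>..\<beta>}. dist (f n t) (G t) < e"
    using f
  proof eventually_elim
    case (elim n)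
    show ?case
    proof
      fix t assume t: "t \<in> {\<alpha>..\<beta>}"
      have "norm ((\<lambda>t. f n t - G t) t - (\<lambda>t. f n t - G t) (x n)) \<le> e' * norm (t - x n)"
      proof (rule field_differentiable_bound[of "{\<alpha>..\<beta>}" _ "\<lambda>t. f' n t - g' t"])
        fix z assume "z \<in> {\<alpha>..\<beta>}"
        then show "((\<lambda>t. f n t - G t) has_real_derivative f' n z - g' z) (at z within {\<alpha>..\<beta>})"
          using elim(3) G by (intro DERIV_subset[OF DERIV_diff]) auto
        show "norm (f' n z - g' z) \<le> e'"
          using elim(1) \<open>z \<in> _\<close> by (force simp: dist_real_def)
      qed (use t x in auto)
      also have "\<dots> \<le> e' * (\<beta> - \<alpha>)"
        using t x(1)[of n] e' by (intro mult_left_mono) auto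
      finally show "dist (f n t) (G t) < e"
        using elim(2) e'_le unfolding dist_real_def real_norm_def by linarith
    qed
  qed
qed

context phi_bvp
begin

text \<open>A peak of height at least lo forces P to change by at least a fixed amount between the
  peak and the nearer end, by \<open>peak_left\<close> and \<open>peak_right\<close>. Since P is
  continuous at 0 and 1, this excludes peaks near the ends, uniformly in the truncation and the
  delay.\<close>

lemma peak_away_from_ends:
  assumes lo: "0 < lo"
  obtains e where "0 < e" "e \<le> 1/2"
    "\<And>\<delta> a b u w \<sigma>. delayed_sol lam \<delta> a b u w \<Longrightarrow> 0 < a \<Longrightarrow> a < b \<Longrightarrow> b < 1 \<Longrightarrow> 0 \<le> lam \<Longrightarrow>
       u b = 0 \<Longrightarrow> \<sigma> \<in> {a<..<b} \<Longrightarrow> w \<sigma> = 0 \<Longrightarrow> lo \<le> u \<sigma> \<Longrightarrow>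
       (\<And>t. t \<in> {a<..<b} \<Longrightarrow> F (u (max a (t - \<delta>))) \<le> M) \<Longrightarrow> \<sigma> \<in> {e..1 - e}"
proof -
  define K where "K = \<bar>k (lam * M / d0) / c0\<bar>"
  have K: "0 \<le> K" by (simp add: K_def)
  have cont: "\<exists>e>0. \<forall>t\<in>{0..1}. dist t s < e \<longrightarrow> dist (P t) (P s) < lo / (K + 1)" if "s \<in> {0..1}" for s
    using P_cont[unfolded continuous_on_iff, rule_format, OF that, of "lo / (K + 1)"] lo K by simp
  from cont[of 0] obtain e1 where e1: "0 < e1"
    "\<And>t. t \<in> {0..1} \<Longrightarrow> dist t 0 < e1 \<Longrightarrow> dist (P t) (P 0) < lo / (K + 1)" by auto
  from cont[of 1] obtain e2 where e2: "0 < e2"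
    "\<And>t. t \<in> {0..1} \<Longrightarrow> dist t 1 < e2 \<Longrightarrow> dist (P t) (P 1) < lo / (K + 1)" by auto
  define e where "e = min (1/2) (min e1 e2)"
  have no: False if "lo \<le> k (lam * M / d0) / c0 * X" "0 \<le> X" "X < lo / (K + 1)" for X
  proof -
    have "k (lam * M / d0) / c0 \<le> K" unfolding K_def by (rule abs_ge_self)
    from mult_right_mono[OF this that(2)] that(1) have "lo \<le> K * X" by linarith
    also have "\<dots> \<le> (K + 1) * X" using that by (simp add: algebra_simps)
    also have "\<dots> < lo" using that K by (simp add: pos_less_divide_eq mult.commute)
    finally show False by simp
  qed
  show thesis
  proof (rule that[of e])
    fix \<delta> a b u w \<sigma>
    assume sol: "delayed_sol lam \<delta> a b u w" and ab: "0 < a" "a < b" "b < 1" and lam: "0 \<le> lam"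
      and ub: "u b = 0" and \<sigma>: "\<sigma> \<in> {a<..<b}" "w \<sigma> = 0" "lo \<le> u \<sigma>"
      and M: "\<And>t. t \<in> {a<..<b} \<Longrightarrow> F (u (max a (t - \<delta>))) \<le> M"
    have "0 \<le> M" using M[OF \<sigma>(1)] F_nonneg by (rule order_trans[rotated])
    then have K0: "0 \<le> k (lam * M / d0) / c0" using lam c0 d0 by (simp add: k_nonneg)
    have "e \<le> \<sigma>"
    proof (rule ccontr)
      assume "\<not> e \<le> \<sigma>"
      then have s: "\<sigma> < e1" "\<sigma> \<le> 1/2" by (auto simp: e_def)
      have "u \<sigma> \<le> k (lam * M / d0) / c0 * (P \<sigma> - P a)"
        using peak_left[OF sol lam ab M] \<sigma> s by auto
      also have "\<dots> \<le> k (lam * M / d0) / c0 * (P \<sigma> - P 0)"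
        using P_mono[of 0 a] ab by (intro mult_left_mono[OF _ K0]) auto
      finally show False
        using no[of "P \<sigma> - P 0"] e1(2)[of \<sigma>] P_mono[of 0 \<sigma>] \<sigma> ab s by (auto simp: dist_real_def)
    qed
    moreover have "\<sigma> \<le> 1 - e"
    proof (rule ccontr)
      assume "\<not> \<sigma> \<le> 1 - e"
      then have s: "1 - \<sigma> < e2" "1/2 \<le> \<sigma>" by (auto simp: e_def)
      have "u \<sigma> \<le> k (lam * M / d0) / c0 * (P b - P \<sigma>)"
        using peak_right[OF sol lam ab M] \<sigma> s ub by auto
      also have "\<dots> \<le> k (lam * M / d0) / c0 * (P 1 - P \<sigma>)"
        using P_mono[of b 1] ab by (intro mult_left_mono[OF _ K0]) auto
      finally show False
        using no[of "P 1 - P \<sigma>"] e2(2)[of \<sigma>] P_mono[of \<sigma> 1] \<sigma> ab s by (auto simp: dist_real_def)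
    qed
    ultimately show "\<sigma> \<in> {e..1 - e}" by simp
  qed (use e1 e2 in \<open>auto simp: e_def\<close>)
qed

text \<open>Substitute for subadditivity: x + y is at most twice the larger of the two.\<close>

lemma k_add_le:
  assumes "0 \<le> x" "0 \<le> y"
  shows "k (x + y) \<le> k (2 * x) + k (2 * y)"
proof (cases "x \<le> y")
  case True
  then have "k (x + y) \<le> k (2 * y)" by (simp add: k_le)
  then show ?thesis using k_nonneg[of "2 * x"] assms by simp
next
  case False
  then have "k (x + y) \<le> k (2 * x)" by (simp add: k_le)
  then show ?thesis using k_nonneg[of "2 * y"] assms by simp
qed

text \<open>Measured from its zero at the peak, the flux at t is at most lam * M * (|H t| + C),
  where C bounds |H| on [e, 1 - e], hence at every admissible peak. \<open>k_add_le\<close> and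
  \<open>k_mult\<close> turn this into the slope bound C1 * J |H t| + C2, the derivative of Q = C1 *
  P + C2 * t. The slope bound may blow up at 0 and 1, but Q is continuous up to them.\<close>

lemma equicontinuity_modulus:
  assumes e: "0 < e" "e \<le> 1/2" and M: "0 \<le> M" and lam: "0 \<le> lam"
  obtains Q where "continuous_on {0..1} Q"
    "\<And>\<delta> a b u w \<sigma> x y. delayed_sol lam \<delta> a b u w \<Longrightarrow> 0 < a \<Longrightarrow> a < b \<Longrightarrow> b < 1 \<Longrightarrow>
       \<sigma> \<in> {a<..<b} \<Longrightarrow> w \<sigma> = 0 \<Longrightarrow> \<sigma> \<in> {e..1 - e} \<Longrightarrow>
       (\<And>t. t \<in> {a<..<b} \<Longrightarrow> F (u (max a (t - \<delta>))) \<le> M) \<Longrightarrow>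
       a \<le> x \<Longrightarrow> x \<le> y \<Longrightarrow> y \<le> b \<Longrightarrow> \<bar>u y - u x\<bar> \<le> Q y - Q x"
    "\<And>x y. 0 \<le> x \<Longrightarrow> x \<le> y \<Longrightarrow> y \<le> 1 \<Longrightarrow> Q x \<le> Q y"
proof -
  define C where "C = max \<bar>H e\<bar> \<bar>H (1 - e)\<bar>"
  define A where "A = lam * M / d0"
  define C1 where "C1 = k (2 * A) / c0"
  define C2 where "C2 = k (2 * (A * C)) / c0"
  define Q where "Q = (\<lambda>t. C1 * P t + C2 * t)"
  have A: "0 \<le> A" using lam M d0 by (simp add: A_def)
  have C: "0 \<le> C" by (simp add: C_def)
  have C1: "0 \<le> C1" and C2: "0 \<le> C2"
    using A C c0 by (auto simp: C1_def C2_def k_nonneg)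
  have Qc: "continuous_on {0..1} Q"
    unfolding Q_def by (intro continuous_intros P_cont)
  show thesis
  proof (rule that[OF Qc])
    fix \<delta> a b u w \<sigma> x y
    assume sol: "delayed_sol lam \<delta> a b u w" and ab: "0 < a" "a < b" "b < 1"
      and \<sigma>: "\<sigma> \<in> {a<..<b}" "w \<sigma> = 0" "\<sigma> \<in> {e..1 - e}"
      and MF: "\<And>t. t \<in> {a<..<b} \<Longrightarrow> F (u (max a (t - \<delta>))) \<le> M"
      and xy: "a \<le> x" "x \<le> y" "y \<le> b"
    have H\<sigma>: "\<bar>H \<sigma>\<bar> \<le> C"
      using H_mono[of e \<sigma>] H_mono[of \<sigma> "1 - e"] \<sigma> e by (auto simp: C_def)
    have w: "\<bar>w t\<bar> \<le> lam * M * (\<bar>H t\<bar> + C)" if t: "a \<le> t" "t \<le> b" for t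
    proof (cases "t \<le> \<sigma>")
      case True
      have "w t - w \<sigma> \<le> lam * M * (H \<sigma> - H t)"
        using True t \<sigma> by (intro w_diff_le[OF sol lam ab] MF) auto
      also have "\<dots> \<le> lam * M * (\<bar>H t\<bar> + C)"
        using H\<sigma> lam M by (intro mult_left_mono) auto
      finally show ?thesis
        using w_decr[OF sol lam ab, of t \<sigma>] True t \<sigma> by auto
    next
      case False
      have "w \<sigma> - w t \<le> lam * M * (H t - H \<sigma>)"
        using False t \<sigma> by (intro w_diff_le[OF sol lam ab] MF) auto
      also have "\<dots> \<le> lam * M * (\<bar>H t\<bar> + C)"
        using H\<sigma> lam M by (intro mult_left_mono) auto
      finally show ?thesis
        using w_decr[OF sol lam ab, of \<sigma> t] False t \<sigma> by auto
    qed
    have bound: "k (lam * M * (\<bar>H t\<bar> + C) / d0) / c0 \<le> C1 * J \<bar>H t\<bar> + C2" for t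
    proof -
      have "lam * M * (\<bar>H t\<bar> + C) / d0 = A * \<bar>H t\<bar> + A * C"
        by (simp add: A_def distrib_left add_divide_distrib)
      then have "k (lam * M * (\<bar>H t\<bar> + C) / d0) \<le> k ((2 * A) * \<bar>H t\<bar>) + k (2 * (A * C))"
        using k_add_le[of "A * \<bar>H t\<bar>" "A * C"] A C by (simp add: mult.assoc)
      also have "\<dots> \<le> k (2 * A) * J \<bar>H t\<bar> + k (2 * (A * C))"
        using k_mult[of "2 * A" "\<bar>H t\<bar>"] A by simp
      finally show ?thesis
        using c0 unfolding C1_def C2_def by (simp add: field_simps)
    qed
    have s: "\<bar>slope t (w t)\<bar> \<le> C1 * J \<bar>H t\<bar> + C2" if t: "a \<le> t" "t \<le> b" for t
    proof -
      have W: "0 \<le> lam * M * (\<bar>H t\<bar> + C)" using lam M C by simp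
      have "slope t (w t) \<le> k (lam * M * (\<bar>H t\<bar> + C) / d0) / c0"
        "slope t (- w t) \<le> k (lam * M * (\<bar>H t\<bar> + C) / d0) / c0"
        using w[OF t] t ab W by (auto intro!: slope_le_pos)
      then show ?thesis using bound[of t] by (simp add: slope_minus abs_le_iff)
    qed
    have Qd: "(Q has_real_derivative C1 * J \<bar>H t\<bar> + C2) (at t)" if "t \<in> {0<..<1}" for t
    proof -
      have "((\<lambda>t. C1 * P t + C2 * t) has_real_derivative C1 * J \<bar>H t\<bar> + C2 * 1) (at t)"
        by (intro DERIV_add DERIV_cmult P_deriv that DERIV_ident)
      then show ?thesis by (simp add: Q_def)
    qed
    have Qxy: "continuous_on {x..y} Q" using xy ab by (intro continuous_on_subset[OF Qc]) auto
    have "u y - u x \<le> Q y - Q x"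
    proof (rule diff_le_diff_of_deriv_le[OF xy(2) _ Qxy])
      show "slope t (w t) \<le> C1 * J \<bar>H t\<bar> + C2" if "x < t" "t < y" for t
        using s[of t] that xy by auto
    qed (use xy ab u_cont[OF sol lam ab] u_deriv[OF sol lam ab] Qd in auto)
    moreover have "- u y - - u x \<le> Q y - Q x"
    proof (rule diff_le_diff_of_deriv_le[OF xy(2) _ Qxy])
      show "- slope t (w t) \<le> C1 * J \<bar>H t\<bar> + C2" if "x < t" "t < y" for t
        using s[of t] that xy by auto
      show "((\<lambda>t. - u t) has_real_derivative - slope t (w t)) (at t)" if "x < t" "t < y" for t
        using that xy by (intro DERIV_minus u_deriv[OF sol lam ab]) auto
      show "continuous_on {x..y} (\<lambda>t. - u t)"
        using xy by (intro continuous_on_minus u_cont[OF sol lam ab])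
    qed (use xy ab Qd in auto)
    ultimately show "\<bar>u y - u x\<bar> \<le> Q y - Q x" by simp
  next
    fix x y :: real assume "0 \<le> x" "x \<le> y" "y \<le> 1"
    then show "Q x \<le> Q y"
      unfolding Q_def using C1 C2 P_mono by (intro add_mono mult_left_mono) auto
  qed
qed


section \<open>Passage to the limit in the truncation and the delay\<close>

lemma slope_cont: "continuous_on ({0..1} \<times> UNIV) (\<lambda>(t, w). slope t w)"
proof -
  have pos: "c t \<noteq> 0" "d t \<noteq> 0" if "t \<in> {0..1}" for t
    using c_pos[of t] d_pos[of t] that by auto
  have "continuous_on ({0..1} \<times> UNIV) (\<lambda>z::real \<times> real. c (fst z))"
    "continuous_on ({0..1} \<times> UNIV) (\<lambda>z::real \<times> real. d (fst z))"
    by (rule continuous_on_compose2[OF c_cont] continuous_on_compose2[OF d_cont];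
        auto intro!: continuous_intros)+
  then have "continuous_on ({0..1} \<times> UNIV) (\<lambda>z. k (snd z / d (fst z)) / c (fst z))"
    using pos
    by (intro continuous_on_divide continuous_on_compose2[OF k_cont] continuous_intros) auto
  then show ?thesis by (simp add: slope_def case_prod_unfold)
qed

text \<open>The flux \<open>\<omega>\<close> is built from g by integration, normalised to vanish at
  the limit \<open>\<tau>\<close> of the peaks. Then w n tends to \<open>\<omega>\<close>, and u n
  tends to an antiderivative Z of the slope of \<open>\<omega>\<close>, uniformly on compact
  subintervals; as v n tends to g, Z and g coincide. No convergence of the fluxes has to be
  assumed.\<close>

lemma limit_is_solution:
  fixes a \<sigma> :: "nat \<Rightarrow> real" and u w v :: "nat \<Rightarrow> real \<Rightarrow> real"
  assumes lam: "0 \<le> lam"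
    and sol: "\<And>n. delayed_sol lam (a n) (a n) (1 - a n) (u n) (w n)"
    and a: "\<And>n. 0 < a n" "\<And>n. a n < 1/2" "a \<longlonglongrightarrow> 0"
    and e: "0 < e" "e \<le> 1/2" "\<And>n. \<sigma> n \<in> {e..1 - e}" "\<sigma> \<longlonglongrightarrow> \<tau>" "\<And>n. w n (\<sigma> n) = 0"
    and v: "\<And>n t. t \<in> {a n..1 - a n} \<Longrightarrow> v n t = u n t"
    and lim: "uniform_limit {0..1} v g sequentially" and g: "continuous_on {0..1} g"
  obtains \<omega> where
    "\<And>t. t \<in> {0<..<1} \<Longrightarrow> (g has_real_derivative slope t (\<omega> t)) (at t)"
    "\<And>t. t \<in> {0<..<1} \<Longrightarrow> (\<omega> has_real_derivative - (lam * (h t * F (g t)))) (at t)"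
proof -
  define \<Phi> where "\<Phi> = (\<lambda>t x. - (lam * (h t * F x)))"
  have \<Phi>c: "continuous_on ({0<..<1} \<times> UNIV) (\<lambda>(t, x). \<Phi> t x)"
  proof -
    have "continuous_on ({0<..<1} \<times> UNIV) (\<lambda>z::real \<times> real. h (fst z))"
      by (rule continuous_on_compose2[OF h_cont]) (auto intro!: continuous_intros)
    moreover have "continuous_on ({0<..<1} \<times> UNIV) (\<lambda>z::real \<times> real. F (snd z))"
      by (rule continuous_on_compose2[OF F_cont]) (auto intro!: continuous_intros)
    ultimately show ?thesis
      unfolding \<Phi>_def case_prod_unfold by (intro continuous_intros)
  qed
  have "continuous_on {0<..<1} (\<lambda>t. (\<lambda>(t, x). \<Phi> t x) (t, g t))"
    by (rule continuous_on_compose2[OF \<Phi>c])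
       (auto intro!: continuous_intros continuous_on_subset[OF g])
  then have "continuous_on {0<..<1} (\<lambda>t. \<Phi> t (g t))" by simp
  from open_interval_antiderivative[OF this] obtain \<omega> where
    \<omega>: "\<omega> \<tau> = 0" "\<And>t. t \<in> {0<..<1} \<Longrightarrow> (\<omega> has_real_derivative \<Phi> t (g t)) (at t)" by metis
  have \<omega>c: "continuous_on {0<..<1} \<omega>"
    by (meson DERIV_isCont \<omega>(2) continuous_at_imp_continuous_on)
  have "continuous_on {0<..<1} (\<lambda>t. (\<lambda>(t, w). slope t w) (t, \<omega> t))"
    by (rule continuous_on_compose2[OF slope_cont]) (auto intro!: continuous_intros \<omega>c)
  then have "continuous_on {0<..<1} (\<lambda>t. slope t (\<omega> t))" by simp
  from open_interval_antiderivative[OF this] obtain Z0 where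
    Z0: "Z0 (1/2) = 0" "\<And>t. t \<in> {0<..<1} \<Longrightarrow> (Z0 has_real_derivative slope t (\<omega> t)) (at t)" by metis
  define Z where "Z = (\<lambda>t. g (1/2) + Z0 t)"
  have Zhalf: "Z (1/2) = g (1/2)" by (simp add: Z_def Z0)
  have Z: "(Z has_real_derivative slope t (\<omega> t)) (at t)" if "t \<in> {0<..<1}" for t
    using DERIV_add[OF DERIV_const Z0(2)[OF that]] by (simp add: Z_def)
  have \<tau>: "\<tau> \<in> {e..1 - e}"
    by (rule closed_sequentially[OF closed_atLeastAtMost e(3,4)])
  have gZ: "g t = Z t" if t: "t \<in> {0<..<1}" for t
  proof -
    \<comment> \<open>The interval must contain t, the point 1/2 where Z is anchored, and all peaks,
      where the fluxes are anchored.\<close>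
    define \<alpha> where "\<alpha> = min t e / 2"
    define \<beta> where "\<beta> = max t (1 - e)"
    have ab: "0 < \<alpha>" "\<beta> < 1" "t \<in> {\<alpha>..\<beta>}" "1/2 \<in> {\<alpha>..\<beta>}" "{e..1-e} \<subseteq> {\<alpha>..\<beta>}"
      using t e(1,2) by (auto simp: \<alpha>_def \<beta>_def max_def)
    have sub: "{\<alpha>..\<beta>} \<subseteq> {0<..<1}" using ab by auto
    have "\<forall>\<^sub>F n in sequentially. a n < min (\<alpha> / 2) (1 - \<beta>)"
      using a(3) ab by (intro order_tendstoD) auto
    \<comment> \<open>The factor 2 ensures that s - a n is still at least a n on the interval, so
      the clamp in the delayed argument is inactive.\<close>
    then have small: "\<forall>\<^sub>F n in sequentially. 2 * a n < \<alpha> \<and> \<beta> < 1 - a n"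
      by eventually_elim auto
    have g': "continuous_on {\<alpha>..\<beta>} g" using ab by (intro continuous_on_subset[OF g]) auto
    have shift: "uniform_limit {\<alpha>..\<beta>} (\<lambda>n s. v n (s - a n)) g sequentially"
      unfolding uniform_limit_iff
    proof (intro allI impI)
      fix \<epsilon> :: real assume \<epsilon>: "0 < \<epsilon>"
      have "uniformly_continuous_on {0..1} g"
        using g by (simp add: compact_uniformly_continuous)
      then obtain \<delta> where \<delta>: "0 < \<delta>"
        "\<And>x y. x \<in> {0..1} \<Longrightarrow> y \<in> {0..1} \<Longrightarrow> dist y x < \<delta> \<Longrightarrow> dist (g y) (g x) < \<epsilon> / 2"
        unfolding uniformly_continuous_on_def using half_gt_zero[OF \<epsilon>] by blast
      have "\<forall>\<^sub>F n in sequentially. \<forall>x\<in>{0..1}. dist (v n x) (g x) < \<epsilon> / 2"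
        using \<epsilon> by (intro uniform_limitD[OF lim]) auto
      moreover have "\<forall>\<^sub>F n in sequentially. a n < \<delta>"
        using a(3) \<delta> by (intro order_tendstoD) auto
      ultimately show "\<forall>\<^sub>F n in sequentially. \<forall>x\<in>{\<alpha>..\<beta>}. dist (v n (x - a n)) (g x) < \<epsilon>"
        using small
      proof eventually_elim
        case (elim n)
        show ?case
        proof
          fix x assume x: "x \<in> {\<alpha>..\<beta>}"
          have "x - a n \<in> {0..1}" "x \<in> {0..1}" "dist (x - a n) x < \<delta>"
            using x elim a(1)[of n] ab by (auto simp: dist_real_def)
          then have "dist (v n (x - a n)) (g (x - a n)) < \<epsilon> / 2" "dist (g (x - a n)) (g x) < \<epsilon> / 2"
            using elim \<delta> by auto
          then show "dist (v n (x - a n)) (g x) < \<epsilon>"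
            using dist_triangle[of "v n (x - a n)" "g x" "g (x - a n)"] by linarith
        qed
      qed
    qed
    have W: "uniform_limit {\<alpha>..\<beta>} w \<omega> sequentially"
    proof (rule uniform_limit_antiderivative)
      show "uniform_limit {\<alpha>..\<beta>} (\<lambda>n t. \<Phi> t (v n (t - a n))) (\<lambda>t. \<Phi> t (g t)) sequentially"
        by (rule uniform_limit_superposition[OF _ continuous_on_subset[OF \<Phi>c] shift g'])
           (use sub in auto)
      show "\<forall>\<^sub>F n in sequentially. \<forall>t\<in>{\<alpha>..\<beta>}. (w n has_real_derivative \<Phi> t (v n (t - a n))) (at t)"
        using small
      proof eventually_elim
        case (elim n)
        show ?case
        proof
          fix s assume s: "s \<in> {\<alpha>..\<beta>}"
          have "max (a n) (s - a n) = s - a n" "v n (s - a n) = u n (s - a n)"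
            using s elim a(1,2)[of n] by (auto intro!: v)
          then show "(w n has_real_derivative \<Phi> s (v n (s - a n))) (at s)"
            using w_deriv[OF sol lam, of n s] s elim a(1,2)[of n] unfolding \<Phi>_def by simp
        qed
      qed
      show "(\<omega> has_real_derivative \<Phi> t (g t)) (at t)" if "t \<in> {\<alpha>..\<beta>}" for t
        using that sub by (intro \<omega>) auto
      show "\<sigma> n \<in> {\<alpha>..\<beta>}" for n using e(3) ab by blast
      have "isCont \<omega> \<tau>" using \<omega>c \<tau> e(1) by (auto simp: continuous_on_eq_continuous_at)
      then have "(\<lambda>n. \<omega> (\<sigma> n)) \<longlonglongrightarrow> \<omega> \<tau>" using e(4) by (rule isCont_tendsto_compose)
      then have "(\<lambda>n. 0 - \<omega> (\<sigma> n)) \<longlonglongrightarrow> 0 - 0" unfolding \<omega>(1) by (intro tendsto_diff tendsto_const)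
      then show "(\<lambda>n. w n (\<sigma> n) - \<omega> (\<sigma> n)) \<longlonglongrightarrow> 0" by (simp add: e(5))
    qed
    have U: "uniform_limit {\<alpha>..\<beta>} u Z sequentially"
    proof (rule uniform_limit_antiderivative)
      show "uniform_limit {\<alpha>..\<beta>} (\<lambda>n t. slope t (w n t)) (\<lambda>t. slope t (\<omega> t)) sequentially"
        by (rule uniform_limit_superposition[OF _ continuous_on_subset[OF slope_cont] W
              continuous_on_subset[OF \<omega>c sub]]) (use ab in auto)
      show "\<forall>\<^sub>F n in sequentially. \<forall>t\<in>{\<alpha>..\<beta>}. (u n has_real_derivative slope t (w n t)) (at t)"
        using small
      proof eventually_elim
        case (elim n)
        then show ?case
          using sol[of n] a(1,2)[of n] unfolding delayed_sol_def by auto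
      qed
      show "(Z has_real_derivative slope t (\<omega> t)) (at t)" if "t \<in> {\<alpha>..\<beta>}" for t
        using that sub by (intro Z) auto
      show "1/2 \<in> {\<alpha>..\<beta>}" by (rule ab)
      have "(\<lambda>n. v n (1/2)) \<longlonglongrightarrow> g (1/2)"
        by (rule tendsto_uniform_limitI[OF lim]) auto
      moreover have "v n (1/2) = u n (1/2)" for n using a(2)[of n] by (intro v) auto
      ultimately have "(\<lambda>n. u n (1/2) - Z (1/2)) \<longlonglongrightarrow> g (1/2) - Z (1/2)"
        by (intro tendsto_diff tendsto_const) simp
      then show "(\<lambda>n. u n (1/2) - Z (1/2)) \<longlonglongrightarrow> 0" using Zhalf by simp
    qed
    have "(\<lambda>n. u n t) \<longlonglongrightarrow> Z t" by (rule tendsto_uniform_limitI[OF U]) (use ab in auto)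
    moreover have "\<forall>\<^sub>F n in sequentially. u n t = v n t"
      using small
    proof eventually_elim
      case (elim n)
      then show ?case using ab a(1)[of n] by (intro v[symmetric]) auto
    qed
    ultimately have "(\<lambda>n. v n t) \<longlonglongrightarrow> Z t" by (simp add: tendsto_cong)
    moreover have "(\<lambda>n. v n t) \<longlonglongrightarrow> g t" by (rule tendsto_uniform_limitI[OF lim]) (use t in auto)
    ultimately show ?thesis using LIMSEQ_unique by blast
  qed
  show thesis
  proof (rule that)
    fix t :: real assume t: "t \<in> {0<..<1}"
    show "(\<omega> has_real_derivative - (lam * (h t * F (g t)))) (at t)"
      using \<omega>(2)[OF t] by (simp add: \<Phi>_def)
    show "(g has_real_derivative slope t (\<omega> t)) (at t)"
      by (rule has_field_derivative_transform_within_open[OF Z[OF t] _ t]) (auto simp: gZ)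
  qed
qed


lemma positive_solution_between:
  assumes F_neg: "\<And>x. x \<le> 0 \<Longrightarrow> F x = F 0" and lam: "0 \<le> lam"
    and p: "0 < p" "\<And>x. x \<le> p \<Longrightarrow> F x \<le> B" "k (lam * B / d0) / c0 * (P 1 - P 0) < p"
    and \<eta>: "0 < \<eta>" "3 * \<eta> \<le> \<gamma>1" "\<gamma>1 < \<gamma>2" "\<gamma>2 \<le> 1 - 2 * \<eta>"
    and q: "0 < q" "0 \<le> \<mu>" "\<And>x. q * \<eta> / (1 + \<kappa>) \<le> x \<Longrightarrow> x \<le> q \<Longrightarrow> \<mu> \<le> F x"
      "q < k (lam * \<mu> * (H \<gamma>2 - H \<gamma>1) / 2 / d1) / c1 * \<eta>"
  obtains g \<omega> where "continuous_on {0..1} g" "g 0 = 0" "g 1 = 0"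
    "\<And>t. t \<in> {0<..<1} \<Longrightarrow> (g has_real_derivative slope t (\<omega> t)) (at t)"
    "\<And>t. t \<in> {0<..<1} \<Longrightarrow> (\<omega> has_real_derivative - (lam * (h t * F (g t)))) (at t)"
    "\<And>t. t \<in> {0<..<1} \<Longrightarrow> 0 < g t"
    "\<And>t. t \<in> {0..1} \<Longrightarrow> g t \<le> max p q"
    "\<exists>t\<in>{0..1}. min p q \<le> g t"
proof -
  define lo where "lo = min p q"
  define hi where "hi = max p q"
  have lo: "0 < lo" "lo \<le> hi" using p q by (auto simp: lo_def hi_def)
  \<comment> \<open>The same number serves as truncation and as delay; being at most
    \<open>\<eta>\<close> fits the margins required for shooting.\<close>
  define a where "a = (\<lambda>n::nat. \<eta> * inverse (real (Suc n)))"
  have a: "0 < a n" "a n \<le> \<eta>" "a n < 1/2" for n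
  proof -
    show "0 < a n" using \<eta> by (simp add: a_def)
    show "a n \<le> \<eta>"
      using \<eta> mult_left_mono[of "inverse (real (Suc n))" 1 \<eta>] by (simp add: a_def field_simps)
    then show "a n < 1/2" using \<eta> by linarith
  qed
  have a_lim: "a \<longlonglongrightarrow> 0"
    unfolding a_def using tendsto_mult_left[OF LIMSEQ_inverse_real_of_nat, of \<eta>] by simp
  have ab: "0 < a n" "a n < 1 - a n" "1 - a n < 1" for n using a[of n] by auto
  define R where "R = (\<lambda>n u w \<sigma>. delayed_sol lam (a n) (a n) (1 - a n) u w \<and> u (1 - a n) = 0 \<and>
      \<sigma> \<in> {a n<..<1 - a n} \<and> w \<sigma> = 0 \<and> lo \<le> u \<sigma> \<and> u \<sigma> \<le> hi \<and>
      (\<forall>t\<in>{a n..1 - a n}. u t \<le> u \<sigma>))"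
  have "\<exists>u w \<sigma>. R n u w \<sigma>" for n
  proof -
    have \<eta>': "2 * \<eta> \<le> \<gamma>1" "2 * \<eta> \<le> \<gamma>1 - a n" "1 - \<eta> \<le> 1 - a n"
      using \<eta> a(2)[of n] by auto
    show ?thesis
    proof (rule delayed_boundary_solution[OF F_neg lam ab(1)[of n] ab(2)[of n] ab(3)[of n]
            a(1)[of n] a(2)[of n] p \<eta>(1) \<eta>'(1) \<eta>(3,4) \<eta>'(2) a(2)[of n] \<eta>'(3) q,
            folded lo_def hi_def])
      fix u w \<sigma>
      assume "delayed_sol lam (a n) (a n) (1 - a n) u w" "u (1 - a n) = 0"
        "\<sigma> \<in> {a n<..<1 - a n}" "w \<sigma> = 0" "lo \<le> u \<sigma>" "u \<sigma> \<le> hi"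
        "\<And>t. t \<in> {a n..1 - a n} \<Longrightarrow> u t \<le> u \<sigma>"
      then have "R n u w \<sigma>" unfolding R_def by (intro conjI ballI)
      then show ?thesis by (intro exI)
    qed
  qed
  then obtain u w \<sigma> where R: "\<And>n. R n (u n) (w n) (\<sigma> n)" by metis
  have sol: "delayed_sol lam (a n) (a n) (1 - a n) (u n) (w n)"
    and ub: "u n (1 - a n) = 0" and \<sigma>: "\<sigma> n \<in> {a n<..<1 - a n}"
    and w\<sigma>: "w n (\<sigma> n) = 0" and u_lo: "lo \<le> u n (\<sigma> n)" for n
    using R[of n] unfolding R_def by blast+
  have u_hi: "u n t \<le> hi" if "t \<in> {a n..1 - a n}" for n t
    using R[of n] that unfolding R_def by (meson order_trans)
  \<comment> \<open>This bound has constants independent of n, so it survives the limit and gives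
    positivity of g.\<close>
  have u_lower: "lo * min (t - a n) (1 - a n - t) \<le> (1 + \<kappa>) * u n t" if "t \<in> {a n..1 - a n}" for n t
  proof (cases "t \<in> {a n<..<1 - a n}")
    case True
    have "lo * min (t - a n) (1 - a n - t) \<le> u n (\<sigma> n) * min (t - a n) (1 - a n - t)"
      using that u_lo[of n] by (intro mult_right_mono) auto
    also have "\<dots> \<le> (1 + \<kappa>) * u n t"
      using True \<sigma>[of n] ub[of n] by (intro lower_bound[OF sol lam ab]) auto
    finally show ?thesis .
  next
    case False
    then have "t = a n \<or> t = 1 - a n" using that by auto
    then show ?thesis using ub[of n] u_start[OF sol lam ab, of n] ab(2)[of n] by auto
  qed
  have u_nonneg: "0 \<le> u n t" if "t \<in> {a n..1 - a n}" for n t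
  proof -
    have "0 \<le> lo * min (t - a n) (1 - a n - t)" using lo that by auto
    then have "0 \<le> (1 + \<kappa>) * u n t" using u_lower[OF that] by linarith
    then show ?thesis using \<kappa>_nonneg by (simp add: zero_le_mult_iff)
  qed
  obtain M where M: "0 \<le> M" "\<And>x. x \<le> hi \<Longrightarrow> F x \<le> M" using F_bounded_above[OF F_neg] by metis
  have FM: "F (u n (max (a n) (t - a n))) \<le> M" if "t \<in> {a n<..<1 - a n}" for n t
    using that a[of n] by (intro M u_hi) auto
  obtain e where e: "0 < e" "e \<le> 1/2" "\<And>n. \<sigma> n \<in> {e..1 - e}"
  proof (rule peak_away_from_ends[OF lo(1), of lam M], goal_cases)
    case (1 e)
    show thesis
      by (rule 1(1)[OF 1(2,3)], rule 1(4)[OF sol ab lam ub \<sigma> w\<sigma> u_lo], rule FM)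
  qed
  obtain Q where Qc: "continuous_on {0..1} Q"
    and Qu: "\<And>n x y. a n \<le> x \<Longrightarrow> x \<le> y \<Longrightarrow> y \<le> 1 - a n \<Longrightarrow> \<bar>u n y - u n x\<bar> \<le> Q y - Q x"
    and Q_mono: "\<And>x y. 0 \<le> x \<Longrightarrow> x \<le> y \<Longrightarrow> y \<le> 1 \<Longrightarrow> Q x \<le> Q y"
  proof (rule equicontinuity_modulus[OF e(1,2) M(1) lam], goal_cases)
    case (1 Q)
    show thesis
      by (rule 1(1)[OF 1(2)], rule 1(3)[OF sol ab \<sigma> w\<sigma> e(3)], rule FM) (use 1(4) in auto)
  qed
  \<comment> \<open>Constant extension to all of [0, 1]; as u n vanishes at both ends of its
    interval, this is extension by 0.\<close>
  define v where "v = (\<lambda>n t. u n (max (a n) (min (1 - a n) t)))"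
  have cl: "max (a n) (min (1 - a n) t) \<in> {a n..1 - a n}" for n t using ab(2)[of n] by auto
  have v_eq: "v n t = u n t" if "t \<in> {a n..1 - a n}" for n t
    using that by (auto simp: v_def max_def min_def)
  have v_range: "0 \<le> v n t" "v n t \<le> hi" for n t
    unfolding v_def by (rule u_nonneg[OF cl] u_hi[OF cl])+
  have vQ: "\<bar>v n y - v n x\<bar> \<le> Q y - Q x" if xy: "0 \<le> x" "x \<le> y" "y \<le> 1" for n x y
  proof (cases "y \<le> a n \<or> 1 - a n \<le> x")
    case True
    then have "v n y = v n x" using xy ab(2)[of n] by (auto simp: v_def max_def min_def)
    then show ?thesis using Q_mono[OF xy] by simp
  next
    case False
    let ?x = "max (a n) (min (1 - a n) x)" and ?y = "max (a n) (min (1 - a n) y)"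
    have "\<bar>v n y - v n x\<bar> \<le> Q ?y - Q ?x"
      unfolding v_def using xy ab(2)[of n] by (intro Qu) auto
    moreover have "Q ?y \<le> Q y" using False xy ab[of n] by (intro Q_mono) auto
    moreover have "Q x \<le> Q ?x" using False xy ab[of n] by (intro Q_mono) auto
    ultimately show ?thesis by linarith
  qed
  have vQ': "\<bar>v n x - v n y\<bar> \<le> \<bar>Q x - Q y\<bar>" if "x \<in> {0..1}" "y \<in> {0..1}" for n x y
    using vQ[of x y n] vQ[of y x n] that by (cases "x \<le> y") auto
  obtain g r where g: "continuous_on {0..1} g" and r: "strict_mono (r :: nat \<Rightarrow> nat)"
    and vg: "\<And>\<epsilon>. 0 < \<epsilon> \<Longrightarrow> \<exists>N. \<forall>n x. n \<ge> N \<and> x \<in> {0..1} \<longrightarrow> norm (v (r n) x - g x) < \<epsilon>"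
  proof (rule Arzela_Ascoli[of "{0..1}" v hi])
    show "norm (v n x) \<le> hi" for n x using v_range[of n x] by simp
    fix x \<epsilon> :: real assume x: "x \<in> {0..1}" and \<epsilon>: "0 < \<epsilon>"
    then obtain \<delta> where \<delta>: "0 < \<delta>" "\<And>y. y \<in> {0..1} \<Longrightarrow> dist y x < \<delta> \<Longrightarrow> dist (Q y) (Q x) < \<epsilon>"
      using Qc unfolding continuous_on_iff by blast
    show "\<exists>d. 0 < d \<and> (\<forall>n y. y \<in> {0..1} \<and> norm (x - y) < d \<longrightarrow> norm (v n x - v n y) < \<epsilon>)"
    proof (intro exI conjI allI impI)
      fix n y assume y: "y \<in> {0..1} \<and> norm (x - y) < \<delta>"
      then have "\<bar>Q x - Q y\<bar> < \<epsilon>" using \<delta>(2)[of y] by (simp add: dist_real_def abs_minus_commute)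
      then show "norm (v n x - v n y) < \<epsilon>" using vQ'[OF x, of y n] y by auto
    qed (rule \<delta>)
  qed auto
  \<comment> \<open>A second extraction makes the peaks converge as well.\<close>
  have "seq_compact {e..1 - e}" by (simp add: compact_imp_seq_compact)
  moreover have "\<forall>n. (\<sigma> \<circ> r) n \<in> {e..1 - e}" using e(3) by simp
  ultimately obtain \<tau> s where s: "strict_mono (s :: nat \<Rightarrow> nat)" and \<tau>: "((\<sigma> \<circ> r) \<circ> s) \<longlonglongrightarrow> \<tau>"
    by (rule seq_compactE)
  define \<rho> where "\<rho> = r \<circ> s"
  have lim: "uniform_limit {0..1} (\<lambda>n. v (\<rho> n)) g sequentially"
    unfolding uniform_limit_iff
  proof (intro allI impI)
    fix \<epsilon> :: real assume "0 < \<epsilon>"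
    from vg[OF this] obtain N where N: "\<And>n x. n \<ge> N \<Longrightarrow> x \<in> {0..1} \<Longrightarrow> norm (v (r n) x - g x) < \<epsilon>"
      by blast
    have "\<forall>x\<in>{0..1}. dist (v (\<rho> n) x) (g x) < \<epsilon>" if "N \<le> n" for n
      using N[of "s n"] seq_suble[OF s, of n] that by (auto simp: \<rho>_def dist_norm)
    then show "\<forall>\<^sub>F n in sequentially. \<forall>x\<in>{0..1}. dist (v (\<rho> n) x) (g x) < \<epsilon>"
      using eventually_sequentially by blast
  qed
  have \<rho>: "strict_mono \<rho>" unfolding \<rho>_def using r s by (rule strict_mono_o)
  have a\<rho>: "(\<lambda>n. a (\<rho> n)) \<longlonglongrightarrow> 0" using LIMSEQ_subseq_LIMSEQ[OF a_lim \<rho>] by (simp add: comp_def)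
  have pt: "(\<lambda>n. v (\<rho> n) t) \<longlonglongrightarrow> g t" if "t \<in> {0..1}" for t
    using lim that by (rule tendsto_uniform_limitI)
  obtain \<omega> where
    \<omega>: "\<And>t. t \<in> {0<..<1} \<Longrightarrow> (g has_real_derivative slope t (\<omega> t)) (at t)"
    "\<And>t. t \<in> {0<..<1} \<Longrightarrow> (\<omega> has_real_derivative - (lam * (h t * F (g t)))) (at t)"
  proof (rule limit_is_solution[of lam "\<lambda>n. a (\<rho> n)" "\<lambda>n. u (\<rho> n)" "\<lambda>n. w (\<rho> n)"
        e "\<lambda>n. \<sigma> (\<rho> n)" \<tau> "\<lambda>n. v (\<rho> n)" g])
    show "(\<lambda>n. \<sigma> (\<rho> n)) \<longlonglongrightarrow> \<tau>" using \<tau> by (simp add: \<rho>_def comp_def)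
  qed (use lam sol a e a\<rho> w\<sigma> v_eq lim g in auto)
  have zero: "v n 0 = 0" "v n 1 = 0" for n
    using ub[of n] u_start[OF sol lam ab, of n] ab[of n] by (auto simp: v_def max_def min_def)
  show thesis
  proof (rule that[OF g _ _ \<omega>])
    show "g 0 = 0" "g 1 = 0"
      using pt[of 0] pt[of 1] by (simp_all add: zero LIMSEQ_const_iff)
    show "g t \<le> max p q" if "t \<in> {0..1}" for t
      using LIMSEQ_le_const2[OF pt[OF that], of hi] v_range unfolding hi_def by blast
    show "0 < g t" if t: "t \<in> {0<..<1}" for t
    proof -
      have "\<forall>\<^sub>F n in sequentially. a (\<rho> n) < min t (1 - t)"
        using a\<rho> t by (intro order_tendstoD) auto
      then have "\<forall>\<^sub>F n in sequentially.
          lo * min (t - a (\<rho> n)) (1 - a (\<rho> n) - t) \<le> (1 + \<kappa>) * v (\<rho> n) t"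
      proof eventually_elim
        case (elim n)
        then have "t \<in> {a (\<rho> n)..1 - a (\<rho> n)}" by auto
        then show ?case using u_lower v_eq by metis
      qed
      moreover have "(\<lambda>n. lo * min (t - a (\<rho> n)) (1 - a (\<rho> n) - t)) \<longlonglongrightarrow> lo * min (t - 0) (1 - 0 - t)"
        by (intro tendsto_intros a\<rho>)
      moreover have "(\<lambda>n. (1 + \<kappa>) * v (\<rho> n) t) \<longlonglongrightarrow> (1 + \<kappa>) * g t"
        using t by (intro tendsto_intros pt) auto
      ultimately have "lo * min (t - 0) (1 - 0 - t) \<le> (1 + \<kappa>) * g t"
        by (intro tendsto_le[OF sequentially_bot])
      moreover have "0 < lo * min (t - 0) (1 - 0 - t)" using lo t by auto
      ultimately have "0 < (1 + \<kappa>) * g t" by linarith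
      then show ?thesis using \<kappa>_nonneg by (simp add: zero_less_mult_iff)
    qed
    have "\<exists>x\<in>{0..1}. \<forall>y\<in>{0..1}. g y \<le> g x"
      by (rule continuous_attains_sup) (auto intro: g)
    then obtain x where x: "x \<in> {0..1}" "\<And>y. y \<in> {0..1} \<Longrightarrow> g y \<le> g x" by blast
    \<comment> \<open>Uniform convergence is evaluated at a moving peak, where v is at least
      lo.\<close>
    have "lo \<le> g x"
    proof (rule ccontr)
      assume "\<not> lo \<le> g x"
      then have "0 < lo - g x" by simp
      from vg[OF this] obtain N where N: "\<And>y. y \<in> {0..1} \<Longrightarrow> \<bar>v (r N) y - g y\<bar> < lo - g x" by auto
      have \<sigma>01: "\<sigma> (r N) \<in> {0..1}" using e(3)[of "r N"] e(1) by auto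
      have "lo \<le> v (r N) (\<sigma> (r N))" using u_lo[of "r N"] \<sigma>[of "r N"] v_eq[of "\<sigma> (r N)" "r N"] by simp
      then show False using N[OF \<sigma>01] x(2)[OF \<sigma>01] by linarith
    qed
    then show "\<exists>t\<in>{0..1}. min p q \<le> g t" using x(1) unfolding lo_def by blast
  qed
qed

end

subsection \<open>Existence between two norm levels\<close>

text \<open>The thresholds for different R are unrelated, so one choice must serve all R. At each x,
  take u with N u at least x if there is one, and otherwise within 1 of the supremum of N, which is
  then finite.\<close>

lemma selection_tending_to_infinity:
  fixes N :: "'a \<Rightarrow> real" and Q :: "real \<Rightarrow> 'a \<Rightarrow> bool"
  assumes large: "\<And>R. \<forall>\<^sub>F x in at_top. \<exists>u. Q x u \<and> R < N u"
  obtains U where "\<forall>\<^sub>F x in at_top. Q x (U x)" "filterlim (\<lambda>x. N (U x)) at_top at_top"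
proof -
  define G where "G = (\<lambda>x u. Q x u \<and> (x \<le> N u \<or> (\<forall>u'. Q x u' \<longrightarrow> N u' - 1 < N u)))"
  have ex: "\<exists>u. G x u" if "Q x u0" for x u0
  proof (cases "\<exists>u. Q x u \<and> x \<le> N u")
    case False
    let ?S = "{N u | u. Q x u}"
    have bdd: "bdd_above ?S" using False by (intro bdd_aboveI[of _ x]) force
    have "?S \<noteq> {}" using that by blast
    then obtain y where "y \<in> ?S" "Sup ?S - 1 < y"
      using less_cSupD[of ?S "Sup ?S - 1"] by auto
    then obtain u where u: "Q x u" "Sup ?S - 1 < N u" by blast
    have "N u' - 1 < N u" if "Q x u'" for u'
      using cSup_upper[OF _ bdd, of "N u'"] that u by force
    then show ?thesis using u unfolding G_def by blast
  qed (auto simp: G_def)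
  define U where "U = (\<lambda>x. SOME u. G x u)"
  have U: "G x (U x)" if "Q x u0" for x u0
    unfolding U_def using ex[OF that] by (rule someI_ex)
  show thesis
  proof (rule that[of U])
    show "\<forall>\<^sub>F x in at_top. Q x (U x)"
      using large[of 0] by eventually_elim (use U in \<open>auto simp: G_def\<close>)
    show "filterlim (\<lambda>x. N (U x)) at_top at_top"
      unfolding filterlim_at_top
    proof
      fix Z :: real
      show "\<forall>\<^sub>F x in at_top. Z \<le> N (U x)"
        using large[of "Z + 1"] eventually_ge_at_top[of Z]
      proof eventually_elim
        case (elim x)
        then obtain u where u: "Q x u" "Z + 1 < N u" by blast
        from U[OF u(1)] show ?case using u elim by (fastforce simp: G_def)
      qed
    qed
  qed
qed

text \<open>Both inner integrals equal |H s| on their half, so the condition says that J |H| is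
  Lebesgue integrable over (0, 1); its indefinite integral is continuous up to the end
  points.\<close>

lemma dominating_antiderivative:
  fixes J h H :: "real \<Rightarrow> real"
  assumes J: "continuous_on {0..} J" "\<And>y. 0 \<le> y \<Longrightarrow> 0 \<le> J y"
    and h: "\<And>t. t \<in> {0<..<1} \<Longrightarrow> 0 \<le> h t"
    and H: "H (1/2) = 0" "\<And>t. t \<in> {0<..<1} \<Longrightarrow> (H has_real_derivative h t) (at t)"
    and fin: "(\<integral>\<^sup>+ s. ennreal (J (integral {s..1/2} h)) * indicator {0<..1/2} s \<partial>lborel)
      + (\<integral>\<^sup>+ s. ennreal (J (integral {1/2..s} h)) * indicator {1/2..<1} s \<partial>lborel) < \<infinity>"
  obtains P where "continuous_on {0..1} P"
    "\<And>t. t \<in> {0<..<1} \<Longrightarrow> (P has_real_derivative J \<bar>H t\<bar>) (at t)"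
proof -
  have Hc: "continuous_on {0<..<1} H"
    by (rule DERIV_continuous_on[OF has_field_derivative_at_within[OF H(2)]])
  have int: "integral {x..y} h = H y - H x" "H x \<le> H y" if "0 < x" "x \<le> y" "y < 1" for x y
  proof -
    have "(h has_integral H y - H x) {x..y}"
      using that H(2)
      by (intro fundamental_theorem_of_calculus)
         (auto simp flip: has_real_derivative_iff_has_vector_derivative intro: has_field_derivative_at_within)
    then show "integral {x..y} h = H y - H x" by (rule integral_unique)
    show "H x \<le> H y"
      using diff_ge_of_deriv_ge[of x y H h 0] that H(2) h continuous_on_subset[OF Hc, of "{x..y}"]
      by (fastforce simp: subset_eq)
  qed
  define G where "G = (\<lambda>t. J \<bar>H t\<bar>)"
  have G0: "0 \<le> G t" for t by (simp add: G_def J)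
  have Gc: "continuous_on {0<..<1} G"
    unfolding G_def by (intro continuous_on_compose2[OF J(1)] continuous_intros Hc) auto
  have meas: "(\<lambda>t. indicator A t *\<^sub>R G t) \<in> borel_measurable borel" if "A \<in> sets borel" "A \<subseteq> {0<..<1}" for A
    using that by (intro borel_measurable_continuous_on_indicator continuous_on_subset[OF Gc])
  have eq1: "(\<integral>\<^sup>+ s. ennreal (J (integral {s..1/2} h)) * indicator {0<..1/2} s \<partial>lborel)
      = (\<integral>\<^sup>+ s. ennreal (indicator {0<..1/2} s *\<^sub>R G s) \<partial>lborel)"
    using int[of _ "1/2"] H(1) by (intro nn_integral_cong) (auto simp: G_def indicator_def)
  have eq2: "(\<integral>\<^sup>+ s. ennreal (J (integral {1/2..s} h)) * indicator {1/2..<1} s \<partial>lborel)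
      = (\<integral>\<^sup>+ s. ennreal (indicator {1/2..<1} s *\<^sub>R G s) \<partial>lborel)"
    using int[of "1/2"] H(1) by (intro nn_integral_cong) (auto simp: G_def indicator_def)
  \<comment> \<open>The two halves share the point 1/2, so the estimate below is an
    inequality.\<close>
  define g where "g = (\<lambda>t. indicator {0<..<1} t *\<^sub>R G t)"
  have "(\<integral>\<^sup>+ s. ennreal (g s) \<partial>lborel)
      \<le> (\<integral>\<^sup>+ s. ennreal (indicator {0<..1/2} s *\<^sub>R G s) + ennreal (indicator {1/2..<1} s *\<^sub>R G s) \<partial>lborel)"
    by (intro nn_integral_mono) (auto simp: g_def indicator_def)
  also have "\<dots> = (\<integral>\<^sup>+ s. ennreal (indicator {0<..1/2} s *\<^sub>R G s) \<partial>lborel)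
      + (\<integral>\<^sup>+ s. ennreal (indicator {1/2..<1} s *\<^sub>R G s) \<partial>lborel)"
    by (intro nn_integral_add)
       (auto intro!: measurable_compose[OF meas measurable_ennreal] simp: subset_eq simp del: real_scaleR_def)
  also have "\<dots> < \<infinity>" using fin unfolding eq1 eq2 .
  finally have "integrable lborel g"
    using meas[of "{0<..<1}"] G0 by (intro integrableI_nonneg) (auto simp: g_def)
  then have "g integrable_on UNIV" by (rule integrable_on_lborel)
  then have g: "g integrable_on {0..1}" by (rule integrable_on_subinterval) simp
  have gc: "continuous_on {0<..<1} g"
    by (rule continuous_on_eq[OF Gc]) (simp add: g_def)
  show thesis
  proof (rule that[of "\<lambda>t. integral {0..t} g"])
    show "continuous_on {0..1} (\<lambda>t. integral {0..t} g)"
      by (rule indefinite_integral_continuous_1[OF g])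
    fix t :: real assume t: "t \<in> {0<..<1}"
    have "continuous (at t) g" using gc t by (simp add: continuous_on_eq_continuous_at)
    then have "continuous (at t within {0..1} - {}) g" by (rule continuous_at_imp_continuous_at_within)
    then have "((\<lambda>u. integral {0..u} g) has_vector_derivative g t) (at t within {0..1} - {})"
      using t by (intro integral_has_vector_derivative_continuous_at[OF g]) auto
    then show "((\<lambda>u. integral {0..u} g) has_real_derivative J \<bar>H t\<bar>) (at t)"
      using t by (simp add: has_real_derivative_iff_has_vector_derivative at_within_Icc_at g_def G_def)
  qed
qed

lemma positive_bounds_on_unit_interval:
  fixes c :: "real \<Rightarrow> real"
  assumes "continuous_on {0..1} c" "\<forall>t\<in>{0..1}. c t > 0"
  obtains c0 c1 where "0 < c0" "\<And>t. t \<in> {0..1} \<Longrightarrow> c0 \<le> c t \<and> c t \<le> c1"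
proof -
  have ne: "{0..1::real} \<noteq> {}" by simp
  obtain x where x: "x \<in> {0..1}" "\<forall>y\<in>{0..1}. c x \<le> c y"
    using continuous_attains_inf[OF compact_Icc ne assms(1)] by blast
  obtain y where "\<forall>x\<in>{0..1}. c x \<le> c y"
    using continuous_attains_sup[OF compact_Icc ne assms(1)] by blast
  then show thesis using that[of "c x" "c y"] x assms(2) by blast
qed

text \<open>\<open>E lam\<close> is the smallness of f relative to \<phi> p required at level p, and
  \<open>\<Lambda> q\<close> the threshold above which trajectories with maximum q overshoot. No
  order between p and q is imposed.\<close>

lemma positive_solutions_between:
  fixes \<phi> \<psi>1 \<psi>2 c d f h :: "real \<Rightarrow> real"
  assumes phi: "odd_incr_homeo \<phi>"
    and A: "condA \<phi> \<psi>1 \<psi>2"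
    and c: "continuous_on {0..1} c" "\<forall>t\<in>{0..1}. c t > 0"
    and d: "continuous_on {0..1} d" "\<forall>t\<in>{0..1}. d t > 0"
    and f: "continuous_on {0..} f" "\<forall>s\<ge>0. f s \<ge> 0" "\<forall>s>0. f s > 0"
    and h: "continuous_on {0<..<1} h" "\<forall>t\<in>{0<..<1}. h t \<ge> 0" "\<exists>t\<in>{0<..<1}. h t \<noteq> 0"
    and hint: "h_condition \<psi>1 h"
  obtains E \<Lambda> :: "real \<Rightarrow> real" where
    "\<And>lam. 0 < lam \<Longrightarrow> 0 < E lam"
    "\<And>lam p q. \<lbrakk>0 < lam; \<Lambda> q < lam; 0 < p; 0 < q; \<forall>x\<in>{0..p}. f x \<le> E lam * \<phi> p\<rbrakk> \<Longrightarrow>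
      \<exists>u. is_pos_solution \<phi> c d h f lam u \<and> min p q \<le> sup_norm01 u \<and> sup_norm01 u \<le> max p q"
proof -
  obtain k where phi_k: "homeomorphism UNIV UNIV \<phi> k"
    and phi_odd: "\<And>x. \<phi> (- x) = - \<phi> x" and phi_mono: "strict_mono \<phi>"
    using phi unfolding odd_incr_homeo_def by blast
  have k_phi [simp]: "k (\<phi> x) = x" and phi_k' [simp]: "\<phi> (k x) = x" for x
    using phi_k by (simp_all add: homeomorphism_def)
  have k_cont: "continuous_on UNIV k" using phi_k by (simp add: homeomorphism_def)
  have k_mono: "strict_mono k"
  proof (rule strict_monoI)
    fix x y :: real assume "x < y"
    then have "\<phi> (k x) < \<phi> (k y)" by simp
    then show "k x < k y" using strict_mono_less[OF phi_mono] by blast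
  qed
  have k_odd: "k (- x) = - k x" for x
    using phi_odd[of "k x"] k_phi by (metis phi_k')
  have phi_0: "\<phi> 0 = 0" using phi_odd[of 0] by simp
  have phi_pos: "0 < \<phi> x" if "0 < x" for x
    using strict_monoD[OF phi_mono that] phi_0 by simp

  define J where "J = inv_into {0..} \<psi>1"
  obtain g1 where psi_g: "homeomorphism {0..} {0..} \<psi>1 g1" and psi_mono: "strict_mono_on {0..} \<psi>1"
    using A unfolding condA_def incr_homeo_nonneg_def by blast
  have J_eq: "J y = g1 y" if "0 \<le> y" for y
  proof -
    have "g1 y \<in> {0..}" "\<psi>1 (g1 y) = y" using psi_g that by (auto simp: homeomorphism_def)
    then show ?thesis unfolding J_def
      by (metis inv_into_f_f psi_mono strict_mono_on_imp_inj_on)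
  qed
  have J_nonneg: "0 \<le> J y" if "0 \<le> y" for y
    using psi_g that J_eq[OF that] by (force simp: homeomorphism_def)
  have psi_J: "\<psi>1 (J y) = y" if "0 \<le> y" for y
    using psi_g that J_eq[OF that] by (simp add: homeomorphism_def)
  have psi_nonneg: "0 \<le> \<psi>1 y" if "0 \<le> y" for y
    using psi_g that by (force simp: homeomorphism_def)
  have J_psi: "J (\<psi>1 y) = y" if "0 \<le> y" for y
    using psi_g that J_eq[OF psi_nonneg[OF that]] by (simp add: homeomorphism_def)
  have J_cont: "continuous_on {0..} J"
    using psi_g J_eq by (auto simp: homeomorphism_def cong: continuous_on_cong_simp)
  have psi_pos: "0 < \<psi>1 y" if "0 < y" for y
    using strict_mono_onD[OF psi_mono, of 0 y] psi_nonneg[of 0] that by auto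
  have k_nonneg: "0 \<le> k z" if "0 \<le> z" for z
    using that strict_mono_less_eq[OF k_mono, of 0 z] k_phi[of 0] phi_0 by simp
  have k_mult: "k (z * y) \<le> k z * J y" if "0 \<le> z" "0 \<le> y" for z y
  proof -
    \<comment> \<open>Condition (A) at the points k z and J y; applying k gives the claim.\<close>
    have "\<phi> (k z) * \<psi>1 (J y) \<le> \<phi> (k z * J y)"
      using A k_nonneg[OF that(1)] J_nonneg[OF that(2)] unfolding condA_def by blast
    then have "z * y \<le> \<phi> (k z * J y)" using psi_J[OF that(2)] by simp
    then have "k (z * y) \<le> k (\<phi> (k z * J y))" using strict_mono_less_eq[OF k_mono] by blast
    then show ?thesis by simp
  qed
  have k_unbounded: "\<exists>x\<ge>0. B \<le> k x" for B
    using phi_pos[of "max B 1"]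
    by (intro exI[of _ "\<phi> (max B 1)"]) (simp add: less_max_iff_disj less_imp_le)

  obtain c0 c1 where c_bounds: "0 < c0" "\<And>t. t \<in> {0..1} \<Longrightarrow> c0 \<le> c t \<and> c t \<le> c1"
    by (rule positive_bounds_on_unit_interval[OF c], rule that)
  obtain d0 d1 where d_bounds: "0 < d0" "\<And>t. t \<in> {0..1} \<Longrightarrow> d0 \<le> d t \<and> d t \<le> d1"
    by (rule positive_bounds_on_unit_interval[OF d], rule that)

  obtain H where H: "H (1/2) = 0" "\<And>t. t \<in> {0<..<1} \<Longrightarrow> (H has_real_derivative h t) (at t)"
    by (rule open_interval_antiderivative[OF h(1)], rule that)
  obtain P where P: "continuous_on {0..1} P"
    "\<And>t. t \<in> {0<..<1} \<Longrightarrow> (P has_real_derivative J \<bar>H t\<bar>) (at t)"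
  proof (rule dominating_antiderivative[OF J_cont J_nonneg _ H])
    show "(\<integral>\<^sup>+ s. ennreal (J (integral {s..1/2} h)) * indicator {0<..1/2} s \<partial>lborel)
      + (\<integral>\<^sup>+ s. ennreal (J (integral {1/2..s} h)) * indicator {1/2..<1} s \<partial>lborel) < \<infinity>"
      using hint unfolding h_condition_def J_def .
  qed (use h(2) in auto)

  define F where "F = (\<lambda>x. f (max 0 x))"
  have F_cont: "continuous_on UNIV F"
    unfolding F_def by (rule continuous_on_compose2[OF f(1)]) (auto intro!: continuous_intros)

  interpret phi_bvp k J c d h H P F c0 c1 d0 d1
    by unfold_locales
       (use k_cont k_mono k_odd k_unbounded J_nonneg k_mult c d c_bounds d_bounds h H P F_cont f
         in \<open>auto simp: F_def\<close>)

  obtain t0 where t0: "0 < t0" "t0 < 1" "0 < h t0"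
    using h(2,3) by (auto simp: less_le)
  \<comment> \<open>An interval around a point with h positive, so that H grows strictly across it;
    \<open>\<eta>\<close> is a margin to both ends.\<close>
  define \<gamma>1 where "\<gamma>1 = t0 / 2"
  define \<gamma>2 where "\<gamma>2 = (1 + t0) / 2"
  define \<eta> where "\<eta> = min (t0 / 6) ((1 - t0) / 4)"
  have \<eta>: "0 < \<eta>" "3 * \<eta> \<le> \<gamma>1" "\<gamma>1 < \<gamma>2" "\<gamma>2 \<le> 1 - 2 * \<eta>" "\<eta> \<le> 1"
    using t0 unfolding \<eta>_def \<gamma>1_def \<gamma>2_def by (auto simp: min_def field_simps)
  have H_less: "H \<gamma>1 < H \<gamma>2"
  proof -
    obtain \<delta> where \<delta>: "0 < \<delta>" "\<forall>e>0. e < \<delta> \<longrightarrow> H t0 < H (t0 + e)"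
      using DERIV_pos_inc_right[OF H(2) t0(3)] t0 by auto
    define e where "e = min (\<delta> / 2) ((1 - t0) / 2)"
    have e: "0 < e" "e < \<delta>" "t0 + e \<le> \<gamma>2" using \<delta> t0 by (auto simp: e_def \<gamma>2_def min_def field_simps)
    have "H \<gamma>1 \<le> H t0" "H (t0 + e) \<le> H \<gamma>2"
      using t0 e by (auto intro!: H_mono simp: \<gamma>1_def \<gamma>2_def)
    then show ?thesis using \<delta> e by force
  qed
  \<comment> \<open>f is positive on a compact interval bounded away from 0, so its minimum there is
    positive.\<close>
  have "\<exists>\<mu>>0. \<forall>x. q * \<eta> / (1 + \<kappa>) \<le> x \<and> x \<le> q \<longrightarrow> \<mu> \<le> F x" if q: "0 < q" for q
  proof -
    have low: "0 < q * \<eta> / (1 + \<kappa>)" using q \<eta> \<kappa>_nonneg by simp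
    have "q * \<eta> / (1 + \<kappa>) \<le> q"
      using q \<eta> \<kappa>_nonneg mult_left_mono[of \<eta> "1 + \<kappa>" q] by (simp add: pos_divide_le_eq)
    then have ne: "{q * \<eta> / (1 + \<kappa>)..q} \<noteq> {}" by simp
    obtain x where x: "x \<in> {q * \<eta> / (1 + \<kappa>)..q}" "\<forall>y\<in>{q * \<eta> / (1 + \<kappa>)..q}. F x \<le> F y"
      using continuous_attains_inf[OF compact_Icc ne continuous_on_subset[OF F_cont subset_UNIV]] by blast
    then have "0 < F x" using low f(3) by (auto simp: F_def)
    then show ?thesis using x by auto
  qed
  then obtain \<mu> where \<mu>: "\<And>q. 0 < q \<Longrightarrow> 0 < \<mu> q"
    "\<And>q x. 0 < q \<Longrightarrow> q * \<eta> / (1 + \<kappa>) \<le> x \<Longrightarrow> x \<le> q \<Longrightarrow> \<mu> q \<le> F x" by metis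

  \<comment> \<open>Chosen so that p * y0 / c0 * (P 1 - P 0) is below p. With \<open>E\<close> as
    defined next, lam * (E lam * \<phi> p) / d0 is exactly \<phi> p * \<psi>1 y0, and k of it is at
    most p * y0.\<close>
  define y0 where "y0 = c0 / (2 * (P 1 - P 0 + 1))"
  have P01: "0 \<le> P 1 - P 0" using P_mono[of 0 1] by simp
  have y0: "0 < y0" using c0 P01 by (simp add: y0_def)
  define E where "E = (\<lambda>lam. d0 * \<psi>1 y0 / lam)"
  \<comment> \<open>The expansion condition at level q, solved for lam after applying
    \<phi>.\<close>
  define \<Lambda> where "\<Lambda> = (\<lambda>q. \<phi> (q * c1 / \<eta>) * 2 * d1 / (\<mu> q * (H \<gamma>2 - H \<gamma>1)))"
  show thesis
  proof (rule that[of E \<Lambda>])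
    show "0 < E lam" if "0 < lam" for lam
      using that d0 psi_pos[OF y0] by (simp add: E_def)
    fix lam p q :: real
    assume lam: "0 < lam" "\<Lambda> q < lam" and p: "0 < p" and q: "0 < q"
      and fp: "\<forall>x\<in>{0..p}. f x \<le> E lam * \<phi> p"
    have FB: "F x \<le> E lam * \<phi> p" if "x \<le> p" for x
      using fp that p by (auto simp: F_def)
    have "lam * (E lam * \<phi> p) / d0 = \<phi> p * \<psi>1 y0"
      using lam d0 by (simp add: E_def field_simps)
    also have "k (\<phi> p * \<psi>1 y0) \<le> k (\<phi> p) * J (\<psi>1 y0)"
      using phi_pos[OF p] psi_pos[OF y0] by (intro k_mult) auto
    also have "\<dots> = p * y0" using y0 by (simp add: J_psi)
    finally have "k (lam * (E lam * \<phi> p) / d0) / c0 * (P 1 - P 0) \<le> p * y0 / c0 * (P 1 - P 0)"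
      using c0 P01 by (intro mult_right_mono divide_right_mono) auto
    also have "\<dots> = p * ((P 1 - P 0) / (2 * (P 1 - P 0 + 1)))"
      using c0 P01 by (simp add: y0_def)
    also have "\<dots> < p * 1"
      using p P01 by (intro mult_strict_left_mono) (auto simp: divide_less_eq)
    finally have contr: "k (lam * (E lam * \<phi> p) / d0) / c0 * (P 1 - P 0) < p" by simp
    have "\<phi> (q * c1 / \<eta>) < lam * \<mu> q * (H \<gamma>2 - H \<gamma>1) / 2 / d1"
      using lam(2) \<mu>(1)[OF q] H_less d1 by (simp add: \<Lambda>_def field_simps)
    then have "k (\<phi> (q * c1 / \<eta>)) < k (lam * \<mu> q * (H \<gamma>2 - H \<gamma>1) / 2 / d1)"
      by (simp only: k_less)
    then have exp: "q < k (lam * \<mu> q * (H \<gamma>2 - H \<gamma>1) / 2 / d1) / c1 * \<eta>"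
      using c1 \<eta>(1) by (simp add: field_simps)
    have F_neg: "F x = F 0" if "x \<le> 0" for x using that by (simp add: F_def)
    obtain g \<omega> where g: "continuous_on {0..1} g" "g 0 = 0" "g 1 = 0"
      "\<And>t. t \<in> {0<..<1} \<Longrightarrow> (g has_real_derivative slope t (\<omega> t)) (at t)"
      "\<And>t. t \<in> {0<..<1} \<Longrightarrow> (\<omega> has_real_derivative - (lam * (h t * F (g t)))) (at t)"
      "\<And>t. t \<in> {0<..<1} \<Longrightarrow> 0 < g t"
      "\<And>t. t \<in> {0..1} \<Longrightarrow> g t \<le> max p q"
      "\<exists>t\<in>{0..1}. min p q \<le> g t"
      by (rule positive_solution_between[OF F_neg less_imp_le[OF lam(1)] p FB contr \<eta>(1-4) q
            less_imp_le[OF \<mu>(1)[OF q]] \<mu>(2)[OF q] exp]) (assumption | rule that)+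
    have \<omega>c: "continuous_on {0<..<1} \<omega>"
      by (rule DERIV_continuous_on[OF has_field_derivative_at_within[OF g(5)]])
    have "continuous_on {0<..<1} (\<lambda>t. (\<lambda>(t, w). slope t w) (t, \<omega> t))"
      by (rule continuous_on_compose2[OF slope_cont]) (auto intro!: continuous_intros \<omega>c)
    then have u'c: "continuous_on {0<..<1} (\<lambda>t. slope t (\<omega> t))" by simp
    have w'c: "continuous_on {0<..<1} (\<lambda>t. - (lam * (h t * F (g t))))"
      by (intro continuous_intros h(1) continuous_on_compose2[OF F_cont] continuous_on_subset[OF g(1)]) auto
    have flux_eq: "\<omega> t = d t * \<phi> (c t * slope t (\<omega> t))" if "t \<in> {0<..<1}" for t
      using c_pos[of t] d_pos[of t] that by (simp add: slope_def)
    have flux_deriv: "((\<lambda>s. d s * \<phi> (c s * slope s (\<omega> s))) has_real_derivative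
        - (lam * (h t * F (g t)))) (at t)" if t: "t \<in> {0<..<1}" for t
      by (rule has_field_derivative_transform_within_open[OF g(5)[OF t] _ t]) (auto intro: flux_eq)
    have eqn: "- (lam * (h t * F (g t))) + lam * h t * f (g t) = 0" if "t \<in> {0<..<1}" for t
      using g(6)[OF that] by (simp add: F_def)
    have "is_pos_solution \<phi> c d h f lam g"
      unfolding is_pos_solution_def is_solution_def
      by (intro conjI exI[of _ "\<lambda>t. slope t (\<omega> t)"]
            exI[of _ "\<lambda>t. - (lam * (h t * F (g t)))"] ballI g(1-4,6) u'c w'c flux_deriv eqn)
    moreover have g_nonneg: "0 \<le> g t" if "t \<in> {0..1}" for t
      using that g(2,3) g(6)[of t] by (cases "t = 0 \<or> t = 1") auto
    have "sup_norm01 g \<le> max p q"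
      unfolding sup_norm01_def using g(7) g_nonneg by (intro cSUP_least) auto
    moreover have "min p q \<le> sup_norm01 g"
    proof -
      obtain t where t: "t \<in> {0..1}" "min p q \<le> g t" using g(8) by blast
      have "bdd_above ((\<lambda>t. \<bar>g t\<bar>) ` {0..1})"
        using g(7) g_nonneg by (intro bdd_aboveI2[of _ _ "max p q"]) auto
      then have "\<bar>g t\<bar> \<le> sup_norm01 g" unfolding sup_norm01_def using t(1) by (intro cSUP_upper)
      then show ?thesis using t by linarith
    qed
    ultimately show "\<exists>u. is_pos_solution \<phi> c d h f lam u \<and> min p q \<le> sup_norm01 u \<and> sup_norm01 u \<le> max p q"
      by blast
  qed
qed

section \<open>Choice of the levels in the two limiting regimes\<close>

theorem theorem3p7:
  fixes \<phi> \<psi>1 \<psi>2 c d f h :: "real \<Rightarrow> real"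
  assumes phi: "odd_incr_homeo \<phi>"
    and A: "condA \<phi> \<psi>1 \<psi>2"
    and c: "continuous_on {0..1} c" "\<forall>t\<in>{0..1}. c t > 0"
    and d: "continuous_on {0..1} d" "\<forall>t\<in>{0..1}. d t > 0"
    and f: "continuous_on {0..} f" "\<forall>s\<ge>0. f s \<ge> 0" "\<forall>s>0. f s > 0"
    and h: "continuous_on {0<..<1} h" "\<forall>t\<in>{0<..<1}. h t \<ge> 0" "\<exists>t\<in>{0<..<1}. h t \<noteq> 0"
    and hint: "h_condition \<psi>1 h"
    and horder: "0 \<le> alpha_h h" "alpha_h h < gamma1_h h" "gamma1_h h < gamma2_h h"
                "gamma2_h h < beta_h h" "beta_h h \<le> 1"
  shows
   "(((\<lambda>s. f s / \<phi> s) \<longlongrightarrow> 0) (at_right 0) \<and>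
     (\<exists>L>0. ((\<lambda>s. f s / \<phi> s) \<longlongrightarrow> L) at_top)
     \<longrightarrow>
     (\<exists>lams>0. \<exists>ms::ereal. ms > 0 \<and>
        (\<exists>U :: real \<Rightarrow> real \<Rightarrow> real.
           (\<forall>lam>lams. is_pos_solution \<phi> c d h f lam (U lam) \<and>
                     0 < sup_norm01 (U lam) \<and> ereal (sup_norm01 (U lam)) < ms) \<and>
           ((\<lambda>lam. sup_norm01 (U lam)) \<longlongrightarrow> 0) at_top) \<and>
        (ms < \<infinity> \<longrightarrow> (\<exists>u. is_pos_solution \<phi> c d h f lams u))))
    \<and>
    ((\<exists>L>0. ((\<lambda>s. f s / \<phi> s) \<longlongrightarrow> L) (at_right 0)) \<and>
     ((\<lambda>s. f s / \<phi> s) \<longlongrightarrow> 0) at_top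
     \<longrightarrow>
     (\<exists>lams>0. \<exists>ms::real. ms \<ge> 0 \<and>
        (\<exists>U :: real \<Rightarrow> real \<Rightarrow> real.
           (\<forall>lam>lams. is_pos_solution \<phi> c d h f lam (U lam) \<and> ms < sup_norm01 (U lam)) \<and>
           filterlim (\<lambda>lam. sup_norm01 (U lam)) at_top at_top) \<and>
        (ms > 0 \<longrightarrow> (\<exists>u. is_pos_solution \<phi> c d h f lams u))))"
proof -
  obtain E \<Lambda> :: "real \<Rightarrow> real" where E: "\<And>lam. 0 < lam \<Longrightarrow> 0 < E lam"
    and between: "\<And>lam p q. \<lbrakk>0 < lam; \<Lambda> q < lam; 0 < p; 0 < q; \<forall>x\<in>{0..p}. f x \<le> E lam * \<phi> p\<rbrakk> \<Longrightarrow>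
      \<exists>u. is_pos_solution \<phi> c d h f lam u \<and> min p q \<le> sup_norm01 u \<and> sup_norm01 u \<le> max p q"
    by (rule positive_solutions_between[OF phi A c d f h hint], rule that)
  have phi_mono: "strict_mono \<phi>" and "\<phi> (- 0) = - \<phi> 0"
    using phi unfolding odd_incr_homeo_def by blast+
  then have phi_0: "\<phi> 0 = 0" by simp
  have phi_pos: "0 < \<phi> x" if "0 < x" for x
    using strict_monoD[OF phi_mono that] phi_0 by simp
  have phi_le: "\<phi> x \<le> \<phi> y" if "x \<le> y" for x y
    using that by (simp add: strict_mono_less_eq[OF phi_mono])
  let ?S = "is_pos_solution \<phi> c d h f"
  have sufficiently_large: "\<exists>lams>0. \<forall>lam>lams. Q lam" if "\<forall>\<^sub>F lam in at_top. Q lam" for Q :: "real \<Rightarrow> bool"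
  proof -
    from that obtain B where B: "\<forall>lam>B. Q lam" unfolding eventually_at_top_dense by blast
    then show ?thesis by (intro exI[of _ "max B 1"]) auto
  qed
  show ?thesis
  proof (intro conjI impI; elim conjE)
    assume f0: "((\<lambda>s. f s / \<phi> s) \<longlongrightarrow> 0) (at_right 0)"
    have small: "\<exists>u. ?S lam u \<and> 0 < sup_norm01 u \<and> sup_norm01 u \<le> q"
      if lam: "0 < lam" "\<Lambda> q < lam" and q: "0 < q" for lam q
    proof -
      have "\<forall>\<^sub>F x in at_right 0. f x / \<phi> x < E lam"
        using f0 E[OF lam(1)] by (rule order_tendstoD)
      then obtain b where b: "0 < b" "\<And>x. 0 < x \<Longrightarrow> x < b \<Longrightarrow> f x / \<phi> x < E lam"
        unfolding eventually_at_right_field by blast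
      \<comment> \<open>Below b the ratio is under \<open>E lam\<close>; p at most q makes q the
        upper bound for the norm.\<close>
      define p where "p = min (b / 2) q"
      have p: "0 < p" "p < b" "p \<le> q" using b q by (auto simp: p_def min_def)
      have pos: "f x \<le> E lam * \<phi> p" if "0 < x" "x \<le> p" for x
      proof -
        have "f x < E lam * \<phi> x"
          using b(2)[of x] that p phi_pos[OF that(1)] by (simp add: pos_divide_less_eq)
        also have "\<dots> \<le> E lam * \<phi> p"
          using E[OF lam(1)] phi_le[OF that(2)] by (intro mult_left_mono) auto
        finally show ?thesis by simp
      qed
      \<comment> \<open>The ratio gives no information at 0, where \<phi> vanishes; continuity of f
        closes the gap.\<close>
      have "f 0 \<le> E lam * \<phi> p"
      proof (rule tendsto_upperbound)
        have "(f \<longlongrightarrow> f 0) (at 0 within {0..})" using f(1) by (simp add: continuous_on)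
        then show "(f \<longlongrightarrow> f 0) (at_right 0)" by (rule tendsto_within_subset) auto
        show "\<forall>\<^sub>F x in at_right 0. f x \<le> E lam * \<phi> p"
          unfolding eventually_at_right_field using p(1) pos by (intro exI[of _ p]) auto
      qed simp
      then have "\<forall>x\<in>{0..p}. f x \<le> E lam * \<phi> p"
        using pos by (metis atLeastAtMost_iff less_eq_real_def)
      from between[OF lam p(1) q this] show ?thesis using p by (auto simp: min_def max_def split: if_splits)
    qed
    \<comment> \<open>Norms tending to 0 are selected through their inverses; keeping positivity in
      the predicate makes the inversion of the norm bound legitimate.\<close>
    let ?Q = "\<lambda>lam u. ?S lam u \<and> 0 < sup_norm01 u"
    have "\<forall>\<^sub>F lam in at_top. \<exists>u. ?Q lam u \<and> R < inverse (sup_norm01 u)" for R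
      using eventually_gt_at_top[of 0] eventually_gt_at_top[of "\<Lambda> (inverse (\<bar>R\<bar> + 1))"]
    proof eventually_elim
      case (elim lam)
      moreover have "0 < \<bar>R\<bar> + 1" by linarith
      ultimately obtain u where u: "?S lam u" "0 < sup_norm01 u" "sup_norm01 u \<le> inverse (\<bar>R\<bar> + 1)"
        using small[of lam "inverse (\<bar>R\<bar> + 1)"] by auto
      have "\<bar>R\<bar> + 1 \<le> inverse (sup_norm01 u)"
        using le_imp_inverse_le[OF u(3,2)] by simp
      then show ?case using u by (intro exI[of _ u]) auto
    qed
    from selection_tending_to_infinity[OF this] obtain U where
      U: "\<forall>\<^sub>F lam in at_top. ?Q lam (U lam)"
      and lim: "filterlim (\<lambda>lam. inverse (sup_norm01 (U lam))) at_top at_top" by blast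
    from sufficiently_large[OF U] obtain lams where
      lams: "0 < lams" "\<forall>lam>lams. ?Q lam (U lam)" by blast
    have "((\<lambda>lam. inverse (inverse (sup_norm01 (U lam)))) \<longlongrightarrow> 0) at_top"
      by (rule tendsto_inverse_0_at_top[OF lim])
    then have "((\<lambda>lam. sup_norm01 (U lam)) \<longlongrightarrow> 0) at_top" by simp
    then show "\<exists>lams>0. \<exists>ms::ereal. ms > 0 \<and>
        (\<exists>U. (\<forall>lam>lams. ?S lam (U lam) \<and> 0 < sup_norm01 (U lam) \<and> ereal (sup_norm01 (U lam)) < ms) \<and>
           ((\<lambda>lam. sup_norm01 (U lam)) \<longlongrightarrow> 0) at_top) \<and>
        (ms < \<infinity> \<longrightarrow> (\<exists>u. ?S lams u))"
      using lams by (intro exI[of _ lams] exI[of _ "\<infinity>::ereal"] conjI exI[of _ U]) auto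
  next
    assume finf: "((\<lambda>s. f s / \<phi> s) \<longlongrightarrow> 0) at_top"
    have large: "\<exists>u. ?S lam u \<and> q \<le> sup_norm01 u"
      if lam: "0 < lam" "\<Lambda> q < lam" and q: "0 < q" for lam q
    proof -
      have "\<forall>\<^sub>F x in at_top. f x / \<phi> x < E lam"
        using finf E[OF lam(1)] by (rule order_tendstoD)
      then obtain b where b: "\<And>x. b < x \<Longrightarrow> f x / \<phi> x < E lam"
        unfolding eventually_at_top_dense by blast
      define s where "s = max b q"
      have s: "0 < s" "b \<le> s" "q \<le> s" using q by (auto simp: s_def)
      have "\<exists>x\<in>{0..s}. \<forall>y\<in>{0..s}. f y \<le> f x"
        using s by (intro continuous_attains_sup continuous_on_subset[OF f(1)]) auto
      then obtain M where M: "\<And>y. y \<in> {0..s} \<Longrightarrow> f y \<le> M" by blast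
      \<comment> \<open>With p at least r, the value \<open>E lam * \<phi> p\<close> dominates the
        bound M of f on [0, s]; beyond s the ratio bound takes over. As r may be negative, p is the
        maximum of r and s.\<close>
      obtain r where r: "M / E lam = \<phi> r"
        using phi unfolding odd_incr_homeo_def homeomorphism_def by (metis UNIV_I imageE)
      define p where "p = max r s"
      have p: "0 < p" "r \<le> p" "s \<le> p" using s by (auto simp: p_def)
      have "f x \<le> E lam * \<phi> p" if x: "x \<in> {0..p}" for x
      proof (cases "x \<le> s")
        case True
        then have "f x \<le> M" using x M by auto
        also have "M = E lam * \<phi> r" using r E[OF lam(1)] by (simp add: field_simps)
        also have "\<dots> \<le> E lam * \<phi> p"
          using E[OF lam(1)] phi_le[OF p(2)] by (intro mult_left_mono) auto
        finally show ?thesis .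
      next
        case False
        then have x0: "0 < x" "b < x" using s by auto
        then have "f x < E lam * \<phi> x"
          using b[of x] phi_pos[OF x0(1)] by (simp add: pos_divide_less_eq)
        also have "\<dots> \<le> E lam * \<phi> p"
          using E[OF lam(1)] phi_le[of x p] x by (intro mult_left_mono) auto
        finally show ?thesis by simp
      qed
      then have "\<forall>x\<in>{0..p}. f x \<le> E lam * \<phi> p" by blast
      from between[OF lam p(1) q this] show ?thesis using p s by (auto simp: min_def split: if_splits)
    qed
    have "\<forall>\<^sub>F lam in at_top. \<exists>u. (?S lam u \<and> 0 < sup_norm01 u) \<and> R < sup_norm01 u" for R
      using eventually_gt_at_top[of 0] eventually_gt_at_top[of "\<Lambda> (\<bar>R\<bar> + 1)"]
    proof eventually_elim
      case (elim lam)
      moreover have "0 < \<bar>R\<bar> + 1" by linarith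
      ultimately obtain u where "?S lam u" "\<bar>R\<bar> + 1 \<le> sup_norm01 u"
        using large[of lam "\<bar>R\<bar> + 1"] by auto
      then show ?case by (intro exI[of _ u]) auto
    qed
    from selection_tending_to_infinity[OF this] obtain U where
      U: "\<forall>\<^sub>F lam in at_top. ?S lam (U lam) \<and> 0 < sup_norm01 (U lam)"
      and lim: "filterlim (\<lambda>lam. sup_norm01 (U lam)) at_top at_top" by blast
    from sufficiently_large[OF U] obtain lams where
      lams: "0 < lams" "\<forall>lam>lams. ?S lam (U lam) \<and> 0 < sup_norm01 (U lam)" by blast
    show "\<exists>lams>0. \<exists>ms::real. ms \<ge> 0 \<and>
        (\<exists>U. (\<forall>lam>lams. ?S lam (U lam) \<and> ms < sup_norm01 (U lam)) \<and>
           filterlim (\<lambda>lam. sup_norm01 (U lam)) at_top at_top) \<and>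
        (ms > 0 \<longrightarrow> (\<exists>u. ?S lams u))"
      using lams lim by (intro exI[of _ lams] exI[of _ 0] conjI exI[of _ U]) auto
  qed
qed

end
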